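(* Let $\alpha=(A,(A_i)_{i\in I_\alpha})$ and $\beta=(B,(B_i)_{i\in I_\beta})$ be two coset incidence systems of finite rank with $I_\alpha\cap I_\beta=\emptyset$, and suppose that $A$ is flag-transitive on $\alpha$ and $B$ is flag-transitive on $\beta$. Let $\alpha*\beta$ be their free product. Then: (a) the group $G=A*B$ is flag-transitive on $\alpha*\beta$; (b) $\alpha*\beta$ is a coset geometry; (c) $\alpha*\beta$ is residually connected if and only if both $\alpha$ and $\beta$ are residually connected; (d) $\alpha*\beta$ is firm if and only if both $\alpha$ and $\beta$ are firm.
   Context: A coset incidence system $(G,(G_i)_{i\in I})$ consists of a group $G$ and a family of subgroups $G_i\le G$ indexed by a type set $I$. It denotes the incidence system whose elements of type $i$ are the left cosets $gG_i$, $g\in G$ (cosets of different types are regarded as different elements), two elements being incident iff their intersection is non-empty. Its rank is $|I|$. A flag is a set of pairwise incident elements; its type is the set of types of its elements; a chamber is a flag of type $I$; the corank of a flag $F$ is $|I|-|F|$. The system is a (coset) geometry if every maximal flag is a chamber. The residue of a flag $F$ is the incidence system of all elements incident to every element of $F$ and not in $F$; for a geometry it has rank $|I|-|F|$. A geometry is residually connected if every residue of rank at least two (including that of the empty flag) has connected incidence graph (so rank 1 geometries are residually connected). It is firm if every residue of a flag of corank one contains at least two elements. $G$ acts by left multiplication; $G$ is flag-transitive if for every $J\subseteq I$ it is transitive on the flags of type $J$. Free product: for $\alpha,\beta$ with $I_\alpha\cap I_\beta=\emptyset$, $\alpha*\beta=(G,(G_i)_{i\in I})$ with $G=A*B$,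 $I=I_\alpha\sqcup I_\beta$, $G_i=\langle A_i,B\rangle = A_i*B$ if $i\in I_\alpha$, and $G_i=\langle A,B_i\rangle=A*B_i$ if $i\in I_\beta$. *)

theory Defs
  imports "HOL-Algebra.Generated_Groups" "HOL-Algebra.Left_Coset"
begin

section \<open>Free product of two groups\<close>

text \<open>
  The free product is realised as the group of reduced words: alternating sequences of
  non-identity elements of the two factors, multiplied by juxtaposition followed by reduction.
\<close>

definition reduced_words ::
    "('a, 'm) monoid_scheme \<Rightarrow> ('b, 'n) monoid_scheme \<Rightarrow> ('a + 'b) list set" where
  "reduced_words A B =
     {w. set w \<subseteq> Inl ` (carrier A - {\<one>\<^bsub>A\<^esub>}) \<union> Inr ` (carrier B - {\<one>\<^bsub>B\<^esub>}) \<and>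
         successively (\<lambda>x y. isl x \<noteq> isl y) w}"

text \<open>
  Reduced form of the product of a single non-identity letter with a reduced word: the letter is
  merged with the first letter of the word if both come from the same factor, and the result is
  dropped if it is the identity.
\<close>

fun prepend ::
    "('a, 'm) monoid_scheme \<Rightarrow> ('b, 'n) monoid_scheme \<Rightarrow> 'a + 'b \<Rightarrow> ('a + 'b) list \<Rightarrow> ('a + 'b) list"
where
  "prepend A B (Inl a) (Inl a' # w) =
     (if a \<otimes>\<^bsub>A\<^esub> a' = \<one>\<^bsub>A\<^esub> then w else Inl (a \<otimes>\<^bsub>A\<^esub> a') # w)"
| "prepend A B (Inr b) (Inr b' # w) =
     (if b \<otimes>\<^bsub>B\<^esub> b' = \<one>\<^bsub>B\<^esub> then w else Inr (b \<otimes>\<^bsub>B\<^esub> b') # w)"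
| "prepend A B x w = x # w"

definition free_product ::
    "('a, 'm) monoid_scheme \<Rightarrow> ('b, 'n) monoid_scheme \<Rightarrow> ('a + 'b) list monoid" where
  "free_product A B =
     \<lparr>carrier = reduced_words A B, mult = (\<lambda>u v. foldr (prepend A B) u v), one = []\<rparr>"

text \<open>The canonical embeddings of the two factors.\<close>

definition embL :: "('a, 'm) monoid_scheme \<Rightarrow> 'a \<Rightarrow> ('a + 'b) list" where
  "embL A a = (if a = \<one>\<^bsub>A\<^esub> then [] else [Inl a])"

definition embR :: "('b, 'n) monoid_scheme \<Rightarrow> 'b \<Rightarrow> ('a + 'b) list" where
  "embR B b = (if b = \<one>\<^bsub>B\<^esub> then [] else [Inr b])"


section \<open>Incidence systems\<close>

record ('x, 'i) incidence_system =
  elements :: "'x set"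
  type_set :: "'i set"
  type_of :: "'x \<Rightarrow> 'i"
  incident :: "'x \<Rightarrow> 'x \<Rightarrow> bool"

text \<open>
  The rank is only used for systems with a finite type set (\<open>card\<close> is 0 on infinite sets).
\<close>

definition rank :: "('x, 'i) incidence_system \<Rightarrow> nat" where
  "rank S = card (type_set S)"

definition flag :: "('x, 'i) incidence_system \<Rightarrow> 'x set \<Rightarrow> bool" where
  "flag S F \<longleftrightarrow> F \<subseteq> elements S \<and> (\<forall>x\<in>F. \<forall>y\<in>F. incident S x y)"

definition flag_type :: "('x, 'i) incidence_system \<Rightarrow> 'x set \<Rightarrow> 'i set" where
  "flag_type S F = type_of S ` F"

definition chamber :: "('x, 'i) incidence_system \<Rightarrow> 'x set \<Rightarrow> bool" where
  "chamber S F \<longleftrightarrow> flag S F \<and> flag_type S F = type_set S"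

definition maximal_flag :: "('x, 'i) incidence_system \<Rightarrow> 'x set \<Rightarrow> bool" where
  "maximal_flag S F \<longleftrightarrow> flag S F \<and> (\<forall>F'. flag S F' \<and> F \<subseteq> F' \<longrightarrow> F' = F)"

definition corank :: "('x, 'i) incidence_system \<Rightarrow> 'x set \<Rightarrow> nat" where
  "corank S F = rank S - card F"

definition geometry :: "('x, 'i) incidence_system \<Rightarrow> bool" where
  "geometry S \<longleftrightarrow> (\<forall>F. maximal_flag S F \<longrightarrow> chamber S F)"

definition residue ::
    "('x, 'i) incidence_system \<Rightarrow> 'x set \<Rightarrow> ('x, 'i) incidence_system" where
  "residue S F =
     \<lparr>elements = {x \<in> elements S. x \<notin> F \<and> (\<forall>y\<in>F. incident S x y)},
      type_set = type_set S - flag_type S F,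
      type_of = type_of S,
      incident = incident S\<rparr>"

definition connected_incidence_graph :: "('x, 'i) incidence_system \<Rightarrow> bool" where
  "connected_incidence_graph S \<longleftrightarrow>
     (\<forall>x\<in>elements S. \<forall>y\<in>elements S.
        (x, y) \<in> {(u, v). u \<in> elements S \<and> v \<in> elements S \<and> u \<noteq> v \<and> incident S u v}\<^sup>*)"

definition residually_connected :: "('x, 'i) incidence_system \<Rightarrow> bool" where
  "residually_connected S \<longleftrightarrow>
     (\<forall>F. flag S F \<and> 2 \<le> rank (residue S F) \<longrightarrow> connected_incidence_graph (residue S F))"

definition firm :: "('x, 'i) incidence_system \<Rightarrow> bool" where
  "firm S \<longleftrightarrow>
     (\<forall>F. flag S F \<and> corank S F = 1 \<longrightarrow>
        (\<exists>x\<in>elements (residue S F). \<exists>y\<in>elements (residue S F). x \<noteq> y))"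


section \<open>Coset incidence systems\<close>

record ('g, 'i) coset_system =
  cs_group :: "'g monoid"
  cs_types :: "'i set"
  cs_subgroup :: "'i \<Rightarrow> 'g set"

definition coset_incidence_system :: "('g, 'i) coset_system \<Rightarrow> bool" where
  "coset_incidence_system \<alpha> \<longleftrightarrow>
     group (cs_group \<alpha>) \<and> (\<forall>i\<in>cs_types \<alpha>. subgroup (cs_subgroup \<alpha> i) (cs_group \<alpha>))"

text \<open>
  A coset is paired with its type, so that cosets of different types are different elements even
  when they coincide as sets. Every element is incident to itself, and distinct elements of the
  same type, being disjoint cosets, are not incident.
\<close>

definition incidence_system_of ::
    "('g, 'i) coset_system \<Rightarrow> ('i \<times> 'g set, 'i) incidence_system" where
  "incidence_system_of \<alpha> =
     \<lparr>elements = (SIGMA i:cs_types \<alpha>. lcosets\<^bsub>cs_group \<alpha>\<^esub> (cs_subgroup \<alpha> i)),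
      type_set = cs_types \<alpha>,
      type_of = fst,
      incident = (\<lambda>x y. snd x \<inter> snd y \<noteq> {})\<rparr>"

definition coset_geometry :: "('g, 'i) coset_system \<Rightarrow> bool" where
  "coset_geometry \<alpha> \<longleftrightarrow> coset_incidence_system \<alpha> \<and> geometry (incidence_system_of \<alpha>)"

definition left_mult :: "('g, 'i) coset_system \<Rightarrow> 'g \<Rightarrow> 'i \<times> 'g set \<Rightarrow> 'i \<times> 'g set" where
  "left_mult \<alpha> g x = (fst x, g <#\<^bsub>cs_group \<alpha>\<^esub> snd x)"

definition flag_transitive :: "('g, 'i) coset_system \<Rightarrow> bool" where
  "flag_transitive \<alpha> \<longleftrightarrow>
     (let S = incidence_system_of \<alpha> in
      \<forall>J\<subseteq>cs_types \<alpha>. \<forall>F F'.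
        flag S F \<and> flag_type S F = J \<and> flag S F' \<and> flag_type S F' = J \<longrightarrow>
        (\<exists>g\<in>carrier (cs_group \<alpha>). left_mult \<alpha> g ` F = F'))"

text \<open>The free product of two coset incidence systems, meant for disjoint type sets.\<close>

definition coset_free_product ::
    "('a, 'i) coset_system \<Rightarrow> ('b, 'i) coset_system \<Rightarrow> (('a + 'b) list, 'i) coset_system" where
  "coset_free_product \<alpha> \<beta> =
     (let A = cs_group \<alpha>; B = cs_group \<beta>; G = free_product A B in
      \<lparr>cs_group = G,
       cs_types = cs_types \<alpha> \<union> cs_types \<beta>,
       cs_subgroup = (\<lambda>i.
         if i \<in> cs_types \<alpha>
         then generate G (embL A ` cs_subgroup \<alpha> i \<union> embR B ` carrier B)
         else generate G (embL A ` carrier A \<union> embR B ` cs_subgroup \<beta> i))\<rparr>)"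

end

theory Submission
  imports Defs
begin

text \<open>
  A coset system is flag-transitive iff the cosets of every flag have a common element. Then all
  flags are translates of standard ones \<open>{G\<^sub>j | j \<in> J}\<close>, and with \<open>G\<^sub>J\<close> the intersection of the
  \<open>G\<^sub>j\<close>, \<open>j \<in> J\<close>, residual connectedness says that \<open>G\<^sub>J\<close> is generated by the subgroups
  \<open>G\<^bsub>J\<union>{i}\<^esub>\<close> whenever \<open>I - J\<close> has at least two elements, while firmness says that
  \<open>G\<^bsub>I-{i}\<^esub>\<close> is not contained in \<open>G\<^sub>i\<close>.

  In the free product, \<open>G\<^sub>J\<close> consists of the reduced words with letters in the corresponding
  intersections of the subgroups of \<open>A\<close> and of \<open>B\<close>, so the two criteria pass between the factors
  and the product; residues with types from both factors are always connected. To find a common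
  element of a flag, add one coset \<open>tG\<^sub>i\<close>, say with \<open>i\<close> a type of \<open>\<alpha>\<close>, to a flag translated
  to be standard: cutting \<open>t = u a w\<close> after its last letter \<open>a \<in> A - A\<^sub>i\<close> makes \<open>u\<close> followed by
  a letter of \<open>aA\<^sub>i\<close> a prefix of every word in \<open>tG\<^sub>i\<close>, which reduces the problem to a flag of \<open>\<alpha>\<close>.
\<close>

section \<open>The group of reduced words\<close>

definition lettersL :: "('a + 'b) list \<Rightarrow> 'a set" where
  "lettersL w = {a. Inl a \<in> set w}"

definition lettersR :: "('a + 'b) list \<Rightarrow> 'b set" where
  "lettersR w = {b. Inr b \<in> set w}"

lemma letters_emb:
  "lettersL (embL A a) = {a} - {\<one>\<^bsub>A\<^esub>}" "lettersR (embL A a) = {}"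
  "lettersL (embR B b) = {}" "lettersR (embR B b) = {b} - {\<one>\<^bsub>B\<^esub>}"
  by (auto simp: lettersL_def lettersR_def embL_def embR_def)

section \<open>Reduced words form a group\<close>

locale group_pair = A: group A + B: group B
  for A :: "('a, 'm) monoid_scheme" and B :: "('b, 'n) monoid_scheme"
begin

abbreviation letters :: "('a + 'b) set" where
  "letters \<equiv> Inl ` (carrier A - {\<one>\<^bsub>A\<^esub>}) \<union> Inr ` (carrier B - {\<one>\<^bsub>B\<^esub>})"

abbreviation pre where "pre \<equiv> prepend A B"

abbreviation RW where "RW \<equiv> reduced_words A B"

lemma Nil_in_RW [simp]: "[] \<in> RW"
  by (simp add: reduced_words_def)

lemma Cons_in_RW:
  "x # w \<in> RW \<longleftrightarrow> x \<in> letters \<and> w \<in> RW \<and> (w = [] \<or> isl x \<noteq> isl (hd w))"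
  by (auto simp: reduced_words_def successively_Cons)

lemma append_in_RW:
  "u @ v \<in> RW \<longleftrightarrow> u \<in> RW \<and> v \<in> RW \<and> (u = [] \<or> v = [] \<or> isl (last u) \<noteq> isl (hd v))"
  by (auto simp: reduced_words_def successively_append_iff)

text \<open>Only the first letter of a word can react with a new letter, so associativity comes down
  to interactions of single letters.\<close>

lemma prepend_Cons: "pre x (y # v) = pre x [y] @ v"
  by (cases x; cases y) auto

lemma prepend_reduced: "x # w \<in> RW \<Longrightarrow> pre x w = x # w"
  by (cases x; cases w; cases "hd w") (auto simp: Cons_in_RW)

lemma prepend_closed: "x \<in> letters \<Longrightarrow> w \<in> RW \<Longrightarrow> pre x w \<in> RW"
  by (cases x; cases w; cases "hd w") (auto simp: Cons_in_RW isl_def)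

text \<open>The core of associativity. Only if \<open>x\<close>, \<open>y\<close> and the first
  letter of \<open>z\<close> come from the same factor do the group axioms of that factor enter; the
  rest of \<open>z\<close> then starts in the other factor and cannot react with anything.\<close>

lemma prepend_prepend:
  assumes "x \<in> letters" "y \<in> letters" "z \<in> RW"
  shows "foldr pre (pre x [y]) z = pre x (pre y z)"
proof (cases z)
  case Nil
  then show ?thesis using assms by (cases x; cases y) auto
next
  case (Cons c z')
  have L: "foldr pre (pre (Inl a) [Inl b]) (Inl d # z') = pre (Inl a) (pre (Inl b) (Inl d # z'))"
    if "a \<in> carrier A" "b \<in> carrier A" "d \<in> carrier A" "a \<noteq> \<one>\<^bsub>A\<^esub>" "d \<noteq> \<one>\<^bsub>A\<^esub>"
      "z' = [] \<or> \<not> isl (hd z')" for a b d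
  proof -
    have "pre (Inl a) z' = Inl a # z'"
      using that by (cases z'; cases "hd z'") auto
    \<comment> \<open>If both products cancel, the left side keeps \<open>d\<close> and the right
      side keeps \<open>a\<close>; both are the inverse of \<open>b\<close>.\<close>
    moreover have "a = d" if "a \<otimes>\<^bsub>A\<^esub> b = \<one>\<^bsub>A\<^esub>" "b \<otimes>\<^bsub>A\<^esub> d = \<one>\<^bsub>A\<^esub>"
      using that \<open>a \<in> _\<close> \<open>b \<in> _\<close> \<open>d \<in> _\<close> by (metis A.inv_equality A.inv_inv)
    moreover have "a \<otimes>\<^bsub>A\<^esub> b \<otimes>\<^bsub>A\<^esub> d = a" if "b \<otimes>\<^bsub>A\<^esub> d = \<one>\<^bsub>A\<^esub>"
      using that \<open>a \<in> _\<close> \<open>b \<in> _\<close> \<open>d \<in> _\<close> by (simp add: A.m_assoc)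
    moreover have "a \<otimes>\<^bsub>A\<^esub> (b \<otimes>\<^bsub>A\<^esub> d) = d" if "a \<otimes>\<^bsub>A\<^esub> b = \<one>\<^bsub>A\<^esub>"
      using that \<open>a \<in> _\<close> \<open>b \<in> _\<close> \<open>d \<in> _\<close> by (simp flip: A.m_assoc)
    ultimately show ?thesis
      using that by (auto simp: A.m_assoc)
  qed
  have R: "foldr pre (pre (Inr a) [Inr b]) (Inr d # z') = pre (Inr a) (pre (Inr b) (Inr d # z'))"
    if "a \<in> carrier B" "b \<in> carrier B" "d \<in> carrier B" "a \<noteq> \<one>\<^bsub>B\<^esub>" "d \<noteq> \<one>\<^bsub>B\<^esub>"
      "z' = [] \<or> isl (hd z')" for a b d
  proof -
    have "pre (Inr a) z' = Inr a # z'"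
      using that by (cases z'; cases "hd z'") auto
    moreover have "a = d" if "a \<otimes>\<^bsub>B\<^esub> b = \<one>\<^bsub>B\<^esub>" "b \<otimes>\<^bsub>B\<^esub> d = \<one>\<^bsub>B\<^esub>"
      using that \<open>a \<in> _\<close> \<open>b \<in> _\<close> \<open>d \<in> _\<close> by (metis B.inv_equality B.inv_inv)
    moreover have "a \<otimes>\<^bsub>B\<^esub> b \<otimes>\<^bsub>B\<^esub> d = a" if "b \<otimes>\<^bsub>B\<^esub> d = \<one>\<^bsub>B\<^esub>"
      using that \<open>a \<in> _\<close> \<open>b \<in> _\<close> \<open>d \<in> _\<close> by (simp add: B.m_assoc)
    moreover have "a \<otimes>\<^bsub>B\<^esub> (b \<otimes>\<^bsub>B\<^esub> d) = d" if "a \<otimes>\<^bsub>B\<^esub> b = \<one>\<^bsub>B\<^esub>"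
      using that \<open>a \<in> _\<close> \<open>b \<in> _\<close> \<open>d \<in> _\<close> by (simp flip: B.m_assoc)
    ultimately show ?thesis
      using that by (auto simp: B.m_assoc)
  qed
  show ?thesis
  proof (cases "isl x = isl y \<and> isl y = isl c")
    case True
    show ?thesis
    proof (cases x)
      case (Inl a)
      then obtain b d where yc: "y = Inl b" "c = Inl d"
        using True by (cases y; cases c) auto
      show ?thesis
        unfolding Cons Inl yc using assms Cons Inl yc by (intro L) (auto simp: Cons_in_RW)
    next
      case (Inr a)
      then obtain b d where yc: "y = Inr b" "c = Inr d"
        using True by (cases y; cases c) auto
      show ?thesis
        unfolding Cons Inr yc using assms Cons Inr yc by (intro R) (auto simp: Cons_in_RW)
    qed
  next
    case False
    then show ?thesis
      using assms Cons by (cases x; cases y; cases c) auto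
  qed
qed

lemma foldr_prepend_closed: "set u \<subseteq> letters \<Longrightarrow> v \<in> RW \<Longrightarrow> foldr pre u v \<in> RW"
  by (induction u) (auto intro!: prepend_closed)

lemma RW_letters: "u \<in> RW \<Longrightarrow> set u \<subseteq> letters"
  by (simp add: reduced_words_def)

text \<open>Passes from a single letter \<open>y\<close> to a word \<open>v\<close>, since
  multiplying \<open>v\<close> by \<open>x\<close> affects only the first letter of
  \<open>v\<close>.\<close>

lemma foldr_prepend_prepend:
  assumes "x \<in> letters" "v \<in> RW" "w \<in> RW"
  shows "foldr pre (pre x v) w = pre x (foldr pre v w)"
proof (cases v)
  case Nil
  then show ?thesis by (cases x) auto
next
  case (Cons y v')
  then have "foldr pre (pre x v) w = foldr pre (pre x [y]) (foldr pre v' w)"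
    by (subst Cons, subst prepend_Cons) simp
  also have "\<dots> = pre x (pre y (foldr pre v' w))"
    using assms Cons RW_letters[of v'] by (intro prepend_prepend foldr_prepend_closed) (auto simp: Cons_in_RW)
  finally show ?thesis by (simp add: Cons)
qed

lemma foldr_prepend_assoc:
  assumes "set u \<subseteq> letters" "v \<in> RW" "w \<in> RW"
  shows "foldr pre (foldr pre u v) w = foldr pre u (foldr pre v w)"
  using assms
  by (induction u) (auto simp: foldr_prepend_prepend foldr_prepend_closed)

lemma foldr_prepend_append: "u @ v \<in> RW \<Longrightarrow> foldr pre u v = u @ v"
  by (induction u) (auto simp: Cons_in_RW prepend_reduced)

lemma prepend_inverse:
  assumes "x \<in> letters"
  obtains y where "y \<in> letters" "pre y [x] = []"
proof (cases x)
  case (Inl a)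
  then show thesis using assms that[of "Inl (inv\<^bsub>A\<^esub> a)"] by (auto simp: image_iff)
next
  case (Inr b)
  then show thesis using assms that[of "Inr (inv\<^bsub>B\<^esub> b)"] by (auto simp: image_iff)
qed

lemma left_inverse: "w \<in> RW \<Longrightarrow> \<exists>y\<in>RW. foldr pre y w = []"
proof (induction w)
  case Nil
  then show ?case by (auto intro!: bexI[of _ "[]"])
next
  case (Cons x w)
  then obtain y where y: "y \<in> RW" "foldr pre y w = []" by (auto simp: Cons_in_RW)
  obtain x' where x': "x' \<in> letters" "pre x' [x] = []"
    using Cons.prems prepend_inverse[of x] unfolding Cons_in_RW by blast
  have 1: "[x'] \<in> RW" using x' by (simp add: Cons_in_RW)
  \<comment> \<open>The left inverse of \<open>x # w\<close> is the inverse of \<open>w\<close>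
    times the inverse letter of \<open>x\<close>. Forming this product in the group avoids checking
    that the juxtaposition is reduced.\<close>
  have "foldr pre (foldr pre y [x']) (x # w) = foldr pre y (pre x' (x # w))"
    using foldr_prepend_assoc[OF RW_letters[OF y(1)] 1 Cons.prems] by simp
  also have "\<dots> = []" by (subst prepend_Cons) (simp add: x' y)
  finally show ?case
    using foldr_prepend_closed[OF RW_letters[OF y(1)] 1] by blast
qed

lemma group_free_product: "group (free_product A B)"
proof (rule groupI)
  show "\<exists>y\<in>carrier (free_product A B). y \<otimes>\<^bsub>free_product A B\<^esub> x = \<one>\<^bsub>free_product A B\<^esub>"
    if "x \<in> carrier (free_product A B)" for x
    using left_inverse that by (simp add: free_product_def)
qed (auto simp: free_product_def RW_letters foldr_prepend_assoc foldr_prepend_closed)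

section \<open>Subgroups described by the letters that they allow\<close>

definition words_over :: "'a set \<Rightarrow> 'b set \<Rightarrow> ('a + 'b) list set" where
  "words_over X Y = {w \<in> carrier (free_product A B). lettersL w \<subseteq> X \<and> lettersR w \<subseteq> Y}"

lemma words_over_eq:
  assumes "X \<subseteq> carrier A" "Y \<subseteq> carrier B"
  shows "words_over X Y = reduced_words (A\<lparr>carrier := X\<rparr>) (B\<lparr>carrier := Y\<rparr>)"
proof -
  have "set w \<subseteq> letters \<and> lettersL w \<subseteq> X \<and> lettersR w \<subseteq> Y \<longleftrightarrow>
    set w \<subseteq> Inl ` (X - {\<one>\<^bsub>A\<^esub>}) \<union> Inr ` (Y - {\<one>\<^bsub>B\<^esub>})" (is "?l \<longleftrightarrow> ?r") for w :: "('a + 'b) list"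
  proof
    assume l: ?l
    show ?r
    proof
      fix x assume "x \<in> set w"
      with l show "x \<in> Inl ` (X - {\<one>\<^bsub>A\<^esub>}) \<union> Inr ` (Y - {\<one>\<^bsub>B\<^esub>})"
        by (cases x) (auto simp: lettersL_def lettersR_def)
    qed
  next
    assume ?r
    moreover have "Inl ` (X - {\<one>\<^bsub>A\<^esub>}) \<union> Inr ` (Y - {\<one>\<^bsub>B\<^esub>}) \<subseteq> letters"
      using assms by blast
    ultimately have "set w \<subseteq> letters" by (rule subset_trans)
    with \<open>?r\<close> show ?l by (auto simp: lettersL_def lettersR_def)
  qed
  then show ?thesis
    unfolding words_over_def free_product_def reduced_words_def by (simp add: set_eq_iff) blast
qed

lemma prepend_carrier_update: "prepend (A\<lparr>carrier := X\<rparr>) (B\<lparr>carrier := Y\<rparr>) = pre"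
proof (intro ext)
  show "prepend (A\<lparr>carrier := X\<rparr>) (B\<lparr>carrier := Y\<rparr>) x w = pre x w" for x w
    by (cases x; cases w; cases "hd w") auto
qed

text \<open>The words over \<open>X\<close> and \<open>Y\<close> are the reduced words of the free
  product of \<open>X\<close> and \<open>Y\<close> as groups of their own, with the same
  multiplication because \<open>prepend\<close> does not look at the carriers. They are thus known
  to form a group.\<close>

lemma subgroup_words_over:
  assumes "subgroup X A" "subgroup Y B"
  shows "subgroup (words_over X Y) (free_product A B)"
proof (rule group.group_incl_imp_subgroup[OF group_free_product])
  show "words_over X Y \<subseteq> carrier (free_product A B)"
    by (auto simp: words_over_def)
  interpret sub: group_pair "A\<lparr>carrier := X\<rparr>" "B\<lparr>carrier := Y\<rparr>"
    using assms by (intro group_pair.intro A.subgroup_imp_group B.subgroup_imp_group)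
  have "free_product (A\<lparr>carrier := X\<rparr>) (B\<lparr>carrier := Y\<rparr>) =
    (free_product A B)\<lparr>carrier := words_over X Y\<rparr>"
    using words_over_eq[of X Y] prepend_carrier_update assms
    by (simp add: free_product_def subgroup.subset)
  then show "group ((free_product A B)\<lparr>carrier := words_over X Y\<rparr>)"
    using sub.group_free_product by simp
qed

lemma embL_hom: "embL A \<in> hom A (free_product A B)"
  by (auto simp: hom_def embL_def free_product_def Cons_in_RW)

lemma embR_hom: "embR B \<in> hom B (free_product A B)"
  by (auto simp: hom_def embR_def free_product_def Cons_in_RW)

text \<open>A reduced word is the product of its letters, and each letter is the image of an element
  of \<open>X\<close> or of \<open>Y\<close>.\<close>

lemma words_over_eq_generate:
  assumes X: "subgroup X A" and Y: "subgroup Y B"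
  shows "words_over X Y = generate (free_product A B) (embL A ` X \<union> embR B ` Y)"
    (is "_ = generate ?G ?E")
proof
  have "?E \<subseteq> words_over X Y"
    using hom_in_carrier[OF embL_hom] hom_in_carrier[OF embR_hom]
      subgroup.mem_carrier[OF X] subgroup.mem_carrier[OF Y]
    by (auto simp: words_over_def letters_emb)
  then show "generate ?G ?E \<subseteq> words_over X Y"
    using X Y by (intro group.generate_subgroup_incl group_free_product subgroup_words_over)
next
  have "w \<in> RW \<longrightarrow> lettersL w \<subseteq> X \<longrightarrow> lettersR w \<subseteq> Y \<longrightarrow> w \<in> generate ?G ?E" for w
  proof (induction w)
    case Nil
    then show ?case using generate.one[of ?G] by (auto simp: free_product_def)
  next
    case (Cons x w)
    show ?case
    proof (intro impI)
      assume *: "x # w \<in> RW" "lettersL (x # w) \<subseteq> X" "lettersR (x # w) \<subseteq> Y"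
      then have w: "w \<in> generate ?G ?E"
        using Cons.IH by (auto simp: Cons_in_RW lettersL_def lettersR_def)
      have "[x] \<in> ?E"
      proof (cases x)
        case (Inl a)
        then have "[x] = embL A a" "a \<in> X"
          using * by (auto simp: Cons_in_RW lettersL_def embL_def)
        then show ?thesis by blast
      next
        case (Inr b)
        then have "[x] = embR B b" "b \<in> Y"
          using * by (auto simp: Cons_in_RW lettersR_def embR_def)
        then show ?thesis by blast
      qed
      then have "[x] \<otimes>\<^bsub>?G\<^esub> w \<in> generate ?G ?E"
        using w by (blast intro: generate.eng generate.incl)
      then show "x # w \<in> generate ?G ?E"
        using * by (simp add: free_product_def prepend_reduced)
    qed
  qed
  then show "words_over X Y \<subseteq> generate ?G ?E"
    by (auto simp: words_over_def free_product_def)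
qed

text \<open>The letter \<open>a\<close> is the last letter of \<open>t\<close> outside \<open>X\<close>; multiplying by a word over \<open>X\<close> and
  \<open>B\<close> on the right can only change it to some \<open>ac \<noteq> 1\<close>, so no cancellation reaches \<open>u\<close>.\<close>

lemma coset_prefixL:
  assumes X: "subgroup X A" and t: "t \<in> carrier (free_product A B)" "\<not> lettersL t \<subseteq> X"
  shows "\<exists>u\<in>carrier (free_product A B). \<exists>a\<in>carrier A. \<exists>w\<in>words_over X (carrier B).
    t = u \<otimes>\<^bsub>free_product A B\<^esub> embL A a \<otimes>\<^bsub>free_product A B\<^esub> w \<and>
    (\<forall>h\<in>words_over X (carrier B). \<exists>c\<in>X.
       let v = u \<otimes>\<^bsub>free_product A B\<^esub> embL A a \<otimes>\<^bsub>free_product A B\<^esub> h in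
       insert (a \<otimes>\<^bsub>A\<^esub> c) (lettersL u) \<subseteq> lettersL v \<and> lettersR u \<subseteq> lettersR v)"
proof -
  interpret G: group "free_product A B" by (rule group_free_product)
  from t(2) have "\<exists>x\<in>set t. x \<in> Inl ` (- X)" by (auto simp: lettersL_def)
  then obtain u x w where split: "t = u @ x # w" "x \<in> Inl ` (- X)" "\<forall>y\<in>set w. y \<notin> Inl ` (- X)"
    by (rule split_list_last_propE) blast
  then obtain a where x: "x = Inl a" "a \<notin> X" by auto
  have tRW: "u @ Inl a # w \<in> RW" using t(1) split(1) x by (simp add: free_product_def)
  then have uRW: "u \<in> RW" and wRW: "w \<in> RW" and a: "a \<in> carrier A" "a \<noteq> \<one>\<^bsub>A\<^esub>"
    and u: "u = [] \<or> \<not> isl (last u)"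
    by (auto simp: append_in_RW Cons_in_RW)
  have mult: "u \<otimes>\<^bsub>free_product A B\<^esub> embL A a \<otimes>\<^bsub>free_product A B\<^esub> h = foldr pre u (pre (Inl a) h)"
    if "h \<in> RW" for h
    using that a uRW by (subst G.m_assoc) (auto simp: free_product_def embL_def Cons_in_RW)
  have wW: "w \<in> words_over X (carrier B)"
    using split(3) wRW RW_letters[OF wRW]
    by (auto simp: words_over_def free_product_def lettersL_def lettersR_def)
  have teq: "t = u \<otimes>\<^bsub>free_product A B\<^esub> embL A a \<otimes>\<^bsub>free_product A B\<^esub> w"
    using tRW by (simp add: mult[OF wRW] split(1) x prepend_reduced foldr_prepend_append append_in_RW)
  have "\<exists>c\<in>X. let v = u \<otimes>\<^bsub>free_product A B\<^esub> embL A a \<otimes>\<^bsub>free_product A B\<^esub> h in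
       insert (a \<otimes>\<^bsub>A\<^esub> c) (lettersL u) \<subseteq> lettersL v \<and> lettersR u \<subseteq> lettersR v"
    if h: "h \<in> words_over X (carrier B)" for h
  proof -
    have hRW: "h \<in> RW" using h by (simp add: words_over_def free_product_def)
    \<comment> \<open>\<open>c\<close> is the first letter of \<open>h\<close> if that letter comes
      from \<open>A\<close>, and the identity otherwise.\<close>
    have "\<exists>c\<in>X. \<exists>h'. pre (Inl a) h = Inl (a \<otimes>\<^bsub>A\<^esub> c) # h'"
    proof (cases "h \<noteq> [] \<and> isl (hd h)")
      case True
      then obtain c h' where c: "h = Inl c # h'" by (cases h; cases "hd h") auto
      then have cX: "c \<in> X" using h by (auto simp: words_over_def lettersL_def)
      \<comment> \<open>Otherwise \<open>a\<close> would be the inverse of \<open>c\<close> and so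
        belong to \<open>X\<close>.\<close>
      have "a \<otimes>\<^bsub>A\<^esub> c \<noteq> \<one>\<^bsub>A\<^esub>"
        using x(2) cX a subgroup.m_inv_closed[OF X] subgroup.mem_carrier[OF X] by (metis A.inv_equality A.inv_inv)
      then show ?thesis using c cX by auto
    next
      case False
      then have "pre (Inl a) h = Inl (a \<otimes>\<^bsub>A\<^esub> \<one>\<^bsub>A\<^esub>) # h"
        using a by (cases h; cases "hd h") auto
      then show ?thesis using subgroup.one_closed[OF X] by blast
    qed
    then obtain c h' where c: "c \<in> X" "pre (Inl a) h = Inl (a \<otimes>\<^bsub>A\<^esub> c) # h'" by blast
    have "pre (Inl a) h \<in> RW" using a hRW by (intro prepend_closed) auto
    then have "u @ pre (Inl a) h \<in> RW"
      unfolding c(2) using uRW u by (simp add: append_in_RW)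
    then have "foldr pre u (pre (Inl a) h) = u @ Inl (a \<otimes>\<^bsub>A\<^esub> c) # h'"
      by (simp add: foldr_prepend_append c(2))
    then show ?thesis
      unfolding Let_def mult[OF hRW] using c(1) by (intro bexI[of _ c]) (auto simp: lettersL_def lettersR_def)
  qed
  moreover have "u \<in> carrier (free_product A B)"
    using uRW by (simp add: free_product_def)
  ultimately show ?thesis
    using teq wW a(1) by blast
qed

text \<open>The mirror image of \<open>coset_prefixL\<close>. The sum type of letters tells the two
  factors apart, so the argument is run again, now splitting at the last letter outside
  \<open>Y\<close>.\<close>

lemma coset_prefixR:
  assumes Y: "subgroup Y B" and t: "t \<in> carrier (free_product A B)" "\<not> lettersR t \<subseteq> Y"
  shows "\<exists>u\<in>carrier (free_product A B). \<exists>b\<in>carrier B. \<exists>w\<in>words_over (carrier A) Y.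
    t = u \<otimes>\<^bsub>free_product A B\<^esub> embR B b \<otimes>\<^bsub>free_product A B\<^esub> w \<and>
    (\<forall>h\<in>words_over (carrier A) Y. \<exists>c\<in>Y.
       let v = u \<otimes>\<^bsub>free_product A B\<^esub> embR B b \<otimes>\<^bsub>free_product A B\<^esub> h in
       lettersL u \<subseteq> lettersL v \<and> insert (b \<otimes>\<^bsub>B\<^esub> c) (lettersR u) \<subseteq> lettersR v)"
proof -
  interpret G: group "free_product A B" by (rule group_free_product)
  from t(2) have "\<exists>x\<in>set t. x \<in> Inr ` (- Y)" by (auto simp: lettersR_def)
  then obtain u x w where split: "t = u @ x # w" "x \<in> Inr ` (- Y)" "\<forall>y\<in>set w. y \<notin> Inr ` (- Y)"
    by (rule split_list_last_propE) blast
  then obtain b where x: "x = Inr b" "b \<notin> Y" by auto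
  have tRW: "u @ Inr b # w \<in> RW" using t(1) split(1) x by (simp add: free_product_def)
  then have uRW: "u \<in> RW" and wRW: "w \<in> RW" and b: "b \<in> carrier B" "b \<noteq> \<one>\<^bsub>B\<^esub>"
    and u: "u = [] \<or> isl (last u)"
    by (auto simp: append_in_RW Cons_in_RW)
  have mult: "u \<otimes>\<^bsub>free_product A B\<^esub> embR B b \<otimes>\<^bsub>free_product A B\<^esub> h = foldr pre u (pre (Inr b) h)"
    if "h \<in> RW" for h
    using that b uRW by (subst G.m_assoc) (auto simp: free_product_def embR_def Cons_in_RW)
  have wW: "w \<in> words_over (carrier A) Y"
    using split(3) wRW RW_letters[OF wRW]
    by (auto simp: words_over_def free_product_def lettersL_def lettersR_def)
  have teq: "t = u \<otimes>\<^bsub>free_product A B\<^esub> embR B b \<otimes>\<^bsub>free_product A B\<^esub> w"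
    using tRW by (simp add: mult[OF wRW] split(1) x prepend_reduced foldr_prepend_append append_in_RW)
  have "\<exists>c\<in>Y. let v = u \<otimes>\<^bsub>free_product A B\<^esub> embR B b \<otimes>\<^bsub>free_product A B\<^esub> h in
       lettersL u \<subseteq> lettersL v \<and> insert (b \<otimes>\<^bsub>B\<^esub> c) (lettersR u) \<subseteq> lettersR v"
    if h: "h \<in> words_over (carrier A) Y" for h
  proof -
    have hRW: "h \<in> RW" using h by (simp add: words_over_def free_product_def)
    have "\<exists>c\<in>Y. \<exists>h'. pre (Inr b) h = Inr (b \<otimes>\<^bsub>B\<^esub> c) # h'"
    proof (cases "h \<noteq> [] \<and> \<not> isl (hd h)")
      case True
      then obtain c h' where c: "h = Inr c # h'" by (cases h; cases "hd h") auto
      then have cY: "c \<in> Y" using h by (auto simp: words_over_def lettersR_def)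
      have "b \<otimes>\<^bsub>B\<^esub> c \<noteq> \<one>\<^bsub>B\<^esub>"
        using x(2) cY b subgroup.m_inv_closed[OF Y] subgroup.mem_carrier[OF Y] by (metis B.inv_equality B.inv_inv)
      then show ?thesis using c cY by auto
    next
      case False
      then have "pre (Inr b) h = Inr (b \<otimes>\<^bsub>B\<^esub> \<one>\<^bsub>B\<^esub>) # h"
        using b by (cases h; cases "hd h") auto
      then show ?thesis using subgroup.one_closed[OF Y] by blast
    qed
    then obtain c h' where c: "c \<in> Y" "pre (Inr b) h = Inr (b \<otimes>\<^bsub>B\<^esub> c) # h'" by blast
    have "pre (Inr b) h \<in> RW" using b hRW by (intro prepend_closed) auto
    then have "u @ pre (Inr b) h \<in> RW"
      unfolding c(2) using uRW u by (simp add: append_in_RW)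
    then have "foldr pre u (pre (Inr b) h) = u @ Inr (b \<otimes>\<^bsub>B\<^esub> c) # h'"
      by (simp add: foldr_prepend_append c(2))
    then show ?thesis
      unfolding Let_def mult[OF hRW] using c(1) by (intro bexI[of _ c]) (auto simp: lettersL_def lettersR_def)
  qed
  moreover have "u \<in> carrier (free_product A B)"
    using uRW by (simp add: free_product_def)
  ultimately show ?thesis
    using teq wW b(1) by blast
qed

end

section \<open>Flag-transitive coset systems\<close>

text \<open>Restricting to the carrier makes the intersection over the empty set of types the whole
  group.\<close>

definition parabolic :: "('g, 'i) coset_system \<Rightarrow> 'i set \<Rightarrow> 'g set" where
  "parabolic \<gamma> J = {g \<in> carrier (cs_group \<gamma>). \<forall>j\<in>J. g \<in> cs_subgroup \<gamma> j}"

text \<open>The translate by \<open>g\<close> of the standard flag of type \<open>J\<close>. For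
  \<open>g\<close> in the group and \<open>J\<close> a set of types, these are the cosets with type
  in \<open>J\<close> that contain \<open>g\<close>.\<close>

definition std_flag :: "('g, 'i) coset_system \<Rightarrow> 'g \<Rightarrow> 'i set \<Rightarrow> ('i \<times> 'g set) set" where
  "std_flag \<gamma> g J = (\<lambda>j. (j, g <#\<^bsub>cs_group \<gamma>\<^esub> cs_subgroup \<gamma> j)) ` J"

text \<open>The form of flag-transitivity used throughout; it mentions no action and can be proved
  by induction on flags.\<close>

definition flags_meet :: "('g, 'i) coset_system \<Rightarrow> bool" where
  "flags_meet \<gamma> \<longleftrightarrow> (\<forall>F. flag (incidence_system_of \<gamma>) F \<longrightarrow>
     (\<exists>g\<in>carrier (cs_group \<gamma>). \<forall>x\<in>F. g \<in> snd x))"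

locale coset_sys = G: group "cs_group \<gamma>" for \<gamma> :: "('g, 'i) coset_system" +
  assumes subgroup_type: "i \<in> cs_types \<gamma> \<Longrightarrow> subgroup (cs_subgroup \<gamma> i) (cs_group \<gamma>)"
begin

abbreviation "G \<equiv> cs_group \<gamma>"
abbreviation "I \<equiv> cs_types \<gamma>"
abbreviation "H \<equiv> cs_subgroup \<gamma>"
abbreviation "S \<equiv> incidence_system_of \<gamma>"
abbreviation "P \<equiv> parabolic \<gamma>"
abbreviation "std \<equiv> std_flag \<gamma>"

lemma coset_mem_iff:
  assumes "i \<in> I" "g \<in> carrier G" "h \<in> carrier G"
  shows "h \<in> g <#\<^bsub>G\<^esub> H i \<longleftrightarrow> inv\<^bsub>G\<^esub> g \<otimes>\<^bsub>G\<^esub> h \<in> H i"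
  using subgroup.lcos_module_imp[OF subgroup_type[OF assms(1)] G.is_group assms(2), of h]
    subgroup.lcos_module_rev[OF subgroup_type[OF assms(1)] G.is_group assms(2,3)] by blast

lemma coset_eq:
  assumes "i \<in> I" "C \<in> lcosets\<^bsub>G\<^esub> (H i)" "g \<in> C"
  shows "g \<in> carrier G" "C = g <#\<^bsub>G\<^esub> H i"
proof -
  obtain a where a: "a \<in> carrier G" "C = a <#\<^bsub>G\<^esub> H i"
    using assms by (auto simp: LCOSETS_def)
  show "g \<in> carrier G"
    using assms subgroup.elemlcos_carrier[OF subgroup_type[OF assms(1)] G.is_group a(1), of g] a(2) by simp
  have "g \<in> a <#\<^bsub>G\<^esub> H i" using a assms by simp
  then show "C = g <#\<^bsub>G\<^esub> H i"
    unfolding a(2) by (rule G.l_repr_independence[OF _ a(1) subgroup_type[OF assms(1)]])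
qed

lemma coset_eq_iff:
  assumes "i \<in> I" "g \<in> carrier G" "h \<in> carrier G"
  shows "g <#\<^bsub>G\<^esub> H i = h <#\<^bsub>G\<^esub> H i \<longleftrightarrow> inv\<^bsub>G\<^esub> g \<otimes>\<^bsub>G\<^esub> h \<in> H i"
proof
  assume "g <#\<^bsub>G\<^esub> H i = h <#\<^bsub>G\<^esub> H i"
  then have "h \<in> g <#\<^bsub>G\<^esub> H i"
    using G.lcos_self[OF assms(3) subgroup_type[OF assms(1)]] by simp
  then show "inv\<^bsub>G\<^esub> g \<otimes>\<^bsub>G\<^esub> h \<in> H i"
    using coset_mem_iff[OF assms] by simp
next
  assume "inv\<^bsub>G\<^esub> g \<otimes>\<^bsub>G\<^esub> h \<in> H i"
  then have "h \<in> g <#\<^bsub>G\<^esub> H i"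
    using coset_mem_iff[OF assms] by simp
  then show "g <#\<^bsub>G\<^esub> H i = h <#\<^bsub>G\<^esub> H i"
    by (rule G.l_repr_independence[OF _ assms(2) subgroup_type[OF assms(1)]])
qed

text \<open>Lets a common translation by \<open>g\<close> drop out when cosets are compared.\<close>

lemma cancel_left:
  assumes "g \<in> carrier G" "p \<in> carrier G" "q \<in> carrier G"
  shows "inv\<^bsub>G\<^esub> (g \<otimes>\<^bsub>G\<^esub> p) \<otimes>\<^bsub>G\<^esub> (g \<otimes>\<^bsub>G\<^esub> q) = inv\<^bsub>G\<^esub> p \<otimes>\<^bsub>G\<^esub> q"
proof -
  have "inv\<^bsub>G\<^esub> g \<otimes>\<^bsub>G\<^esub> (g \<otimes>\<^bsub>G\<^esub> q) = q"
    using assms by (simp flip: G.m_assoc)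
  then show ?thesis
    using assms by (simp add: G.inv_mult_group G.m_assoc)
qed

lemma coset_in_lcosets: "g \<in> carrier G \<Longrightarrow> g <#\<^bsub>G\<^esub> H i \<in> lcosets\<^bsub>G\<^esub> (H i)"
  by (auto simp: LCOSETS_def)

lemma coset_self: "i \<in> I \<Longrightarrow> g \<in> carrier G \<Longrightarrow> g \<in> g <#\<^bsub>G\<^esub> H i"
  using G.lcos_self subgroup_type by blast

lemma flag_iff:
  "flag S F \<longleftrightarrow> (\<forall>x\<in>F. fst x \<in> I \<and> snd x \<in> lcosets\<^bsub>G\<^esub> (H (fst x))) \<and>
     (\<forall>x\<in>F. \<forall>y\<in>F. snd x \<inter> snd y \<noteq> {})"
  by (simp add: flag_def incidence_system_of_def mem_Times_iff subset_iff) force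

lemma flag_type_eq: "flag_type S F = fst ` F"
  by (simp add: flag_type_def incidence_system_of_def)

lemma flag_type_subset: "flag S F \<Longrightarrow> flag_type S F \<subseteq> I"
  by (auto simp: flag_type_eq flag_iff)

lemma flag_std:
  assumes g: "g \<in> carrier G" and J: "J \<subseteq> I"
  shows "flag S (std g J)"
proof -
  have "g \<in> snd x \<and> fst x \<in> I \<and> snd x \<in> lcosets\<^bsub>G\<^esub> (H (fst x))" if "x \<in> std g J" for x
    using that g J coset_self by (auto simp: std_flag_def coset_in_lcosets)
  then show ?thesis unfolding flag_iff by blast
qed

lemma flag_insert:
  assumes "flag S F" "x \<in> elements S" "\<And>y. y \<in> F \<Longrightarrow> snd x \<inter> snd y \<noteq> {}"
  shows "flag S (insert x F)"
proof -
  obtain i a where x: "x = (i, a <#\<^bsub>G\<^esub> H i)" "i \<in> I" "a \<in> carrier G"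
    using assms(2) by (auto simp: incidence_system_of_def LCOSETS_def)
  then have "a \<in> snd x" using coset_self by simp
  moreover have "fst x \<in> I" "snd x \<in> lcosets\<^bsub>G\<^esub> (H (fst x))"
    using x coset_in_lcosets by simp_all
  ultimately show ?thesis
    using assms(1,3) unfolding flag_iff by (simp add: Int_commute) blast
qed

lemma flag_type_std: "flag_type S (std g J) = J"
  by (simp add: flag_type_eq std_flag_def image_image)

lemma parabolic_subgroup:
  assumes "J \<subseteq> I"
  shows "subgroup (P J) G"
proof (intro G.subgroupI)
  have s: "subgroup (H j) G" if "j \<in> J" for j using that assms subgroup_type by blast
  show "P J \<noteq> {}" using subgroup.one_closed[OF s] by (auto simp: parabolic_def)
  show "inv\<^bsub>G\<^esub> a \<in> P J" if "a \<in> P J" for a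
    using that s by (auto simp: parabolic_def subgroup.m_inv_closed)
  show "a \<otimes>\<^bsub>G\<^esub> b \<in> P J" if "a \<in> P J" "b \<in> P J" for a b
    using that s by (auto simp: parabolic_def subgroup.m_closed)
qed (auto simp: parabolic_def)

text \<open>A coset is determined by its type and any one of its elements.\<close>

lemma common_element_std:
  assumes "flag S F" "g \<in> carrier G" "\<And>x. x \<in> F \<Longrightarrow> g \<in> snd x"
    and J: "flag_type S F = J"
  shows "F = std g J"
proof -
  have "x = (fst x, g <#\<^bsub>G\<^esub> H (fst x))" if "x \<in> F" for x
    using that assms coset_eq(2)[of "fst x" "snd x" g] by (auto simp: flag_iff prod_eq_iff)
  then have "F = (\<lambda>x. (fst x, g <#\<^bsub>G\<^esub> H (fst x))) ` F"
    by (metis (no_types, lifting) image_cong image_ident)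
  then show ?thesis
    unfolding J[symmetric] std_flag_def flag_type_eq image_image .
qed

text \<open>An element moving the standard flag of type \<open>J\<close> onto a flag lies in all
  cosets of the latter, since the standard cosets contain the identity. Conversely, if two flags of
  the same type have common elements \<open>g\<close> and \<open>h\<close>, then \<open>h\<close>
  times the inverse of \<open>g\<close> moves the first onto the second.\<close>

lemma flag_transitive_iff: "flag_transitive \<gamma> \<longleftrightarrow> flags_meet \<gamma>"
proof
  assume ft: "flag_transitive \<gamma>"
  show "flags_meet \<gamma>"
    unfolding flags_meet_def
  proof (intro allI impI)
    fix F assume F: "flag S F"
    let ?J = "flag_type S F"
    have J: "?J \<subseteq> I" using F by (rule flag_type_subset)
    have "flag S (std \<one>\<^bsub>G\<^esub> ?J) \<and> flag_type S (std \<one>\<^bsub>G\<^esub> ?J) = ?J \<and> flag S F \<and> ?J = ?J"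
      using F flag_std[OF G.one_closed J] flag_type_std by simp
    then obtain g where g: "g \<in> carrier G" "left_mult \<gamma> g ` std \<one>\<^bsub>G\<^esub> ?J = F"
      using ft[unfolded flag_transitive_def Let_def, rule_format, OF J] by blast
    have "g \<in> snd x" if "x \<in> F" for x
    proof -
      have "x \<in> left_mult \<gamma> g ` std \<one>\<^bsub>G\<^esub> ?J" using that by (simp only: g(2))
      then obtain j where j: "j \<in> ?J" "x = (j, g <#\<^bsub>G\<^esub> (\<one>\<^bsub>G\<^esub> <#\<^bsub>G\<^esub> H j))"
        by (auto simp: std_flag_def left_mult_def)
      then have "j \<in> I" using J by blast
      then show ?thesis
        using j(2) g(1) coset_self subgroup.subset[OF subgroup_type]
        by (simp add: G.lcos_mult_one)
    qed
    then show "\<exists>g\<in>carrier G. \<forall>x\<in>F. g \<in> snd x" using g(1) by blast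
  qed
next
  assume fm: "flags_meet \<gamma>"
  have "\<exists>g\<in>carrier G. left_mult \<gamma> g ` F = F'"
    if F: "flag S F" "flag S F'" and t: "flag_type S F = J" "flag_type S F' = J" for F F' J
  proof -
    have J: "J \<subseteq> I" using t(1) flag_type_subset[OF F(1)] by simp
    note meet = fm[unfolded flags_meet_def, rule_format]
    obtain g h where gh: "g \<in> carrier G" "\<forall>x\<in>F. g \<in> snd x" "h \<in> carrier G" "\<forall>x\<in>F'. h \<in> snd x"
      using meet[OF F(1)] meet[OF F(2)] by metis
    have eq: "F = std g J" "F' = std h J"
      using common_element_std[OF F(1) gh(1) _ t(1)] common_element_std[OF F(2) gh(3) _ t(2)]
        gh(2,4) by simp_all
    let ?k = "h \<otimes>\<^bsub>G\<^esub> inv\<^bsub>G\<^esub> g"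
    have "?k <#\<^bsub>G\<^esub> (g <#\<^bsub>G\<^esub> H j) = h <#\<^bsub>G\<^esub> H j" if "j \<in> J" for j
    proof -
      have "H j \<subseteq> carrier G" using that J subgroup.subset subgroup_type by blast
      moreover have "?k \<otimes>\<^bsub>G\<^esub> g = h" using gh(1,3) by (simp add: G.m_assoc)
      ultimately show ?thesis using gh(1,3) by (simp add: G.lcos_m_assoc)
    qed
    then have "left_mult \<gamma> ?k ` F = F'"
      unfolding eq by (auto simp: std_flag_def left_mult_def image_image)
    then show ?thesis using gh by blast
  qed
  then show "flag_transitive \<gamma>"
    unfolding flag_transitive_def Let_def by (intro allI impI) (elim conjE)
qed

end

section \<open>Residues of flag-transitive systems\<close>

locale flag_transitive_sys = coset_sys +
  assumes flags_meet: "flags_meet \<gamma>"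
begin

lemma flag_common_element:
  assumes "flag S F"
  obtains g where "g \<in> carrier G" "\<And>x. x \<in> F \<Longrightarrow> g \<in> snd x"
proof -
  have "\<exists>g\<in>carrier G. \<forall>x\<in>F. g \<in> snd x"
    using flags_meet[unfolded flags_meet_def, rule_format, OF assms] .
  then show thesis using that by auto
qed

lemma flag_eq_std:
  assumes "flag S F"
  obtains g J where "g \<in> carrier G" "J \<subseteq> I" "F = std g J"
proof -
  obtain g where "g \<in> carrier G" "\<And>x. x \<in> F \<Longrightarrow> g \<in> snd x"
    using flag_common_element[OF assms] by metis
  then show thesis
    using common_element_std[OF assms _ _ refl, of g] flag_type_subset[OF assms] that by blast
qed

text \<open>A flag with common element \<open>g\<close> extends to the chamber of all cosets through
  \<open>g\<close>.\<close>

lemma geometry: "geometry S"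
  unfolding geometry_def
proof (intro allI impI)
  fix F assume F: "maximal_flag S F"
  then have "flag S F" by (simp add: maximal_flag_def)
  then obtain g J where g: "g \<in> carrier G" "J \<subseteq> I" "F = std g J" by (rule flag_eq_std)
  have "flag S (std g I)" using g by (intro flag_std) auto
  moreover have "F \<subseteq> std g I" using g by (auto simp: std_flag_def)
  ultimately have "F = std g I" using F unfolding maximal_flag_def by blast
  then show "chamber S F"
    using \<open>flag S (std g I)\<close> flag_type_std by (simp add: chamber_def incidence_system_of_def)
qed

text \<open>A residue element together with the flag is again a flag, so all its cosets share some
  \<open>h\<close>; then \<open>h\<close> is \<open>g\<close> times an element of \<open>P J\<close>
  and represents the new coset.\<close>

lemma residue_elements:
  assumes g: "g \<in> carrier G" and J: "J \<subseteq> I"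
  shows "elements (residue S (std g J)) = {(i, (g \<otimes>\<^bsub>G\<^esub> p) <#\<^bsub>G\<^esub> H i) | i p. i \<in> I - J \<and> p \<in> P J}"
    (is "_ = ?E")
proof (intro equalityI subsetI)
  fix x assume x: "x \<in> elements (residue S (std g J))"
  then have "flag S (insert x (std g J))"
    using flag_insert[OF flag_std[OF g J], of x] by (auto simp: residue_def incidence_system_of_def)
  then obtain h where h: "h \<in> carrier G" "\<And>y. y \<in> insert x (std g J) \<Longrightarrow> h \<in> snd y"
    using flag_common_element by metis
  obtain i C where xi: "x = (i, C)" "i \<in> I" "C \<in> lcosets\<^bsub>G\<^esub> (H i)"
    using x by (auto simp: residue_def incidence_system_of_def)
  have C: "C = h <#\<^bsub>G\<^esub> H i"
    using coset_eq(2)[OF xi(2,3)] h(2)[of x] xi(1) by simp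
  have hj: "inv\<^bsub>G\<^esub> g \<otimes>\<^bsub>G\<^esub> h \<in> H j" if "j \<in> J" for j
    using h(1) h(2)[of "(j, g <#\<^bsub>G\<^esub> H j)"] that J g coset_mem_iff[of j g h]
    by (auto simp: std_flag_def)
  \<comment> \<open>An incident coset whose type occurs in the flag coincides with the flag element
    of that type, which the residue leaves out.\<close>
  have "i \<notin> J"
  proof
    assume i: "i \<in> J"
    then have "x \<in> std g J"
      using hj[OF i] xi C coset_eq_iff[of i g h] g h(1) by (auto simp: std_flag_def)
    then show False using x by (simp add: residue_def)
  qed
  moreover have "inv\<^bsub>G\<^esub> g \<otimes>\<^bsub>G\<^esub> h \<in> P J" using hj g h(1) by (auto simp: parabolic_def)
  moreover have "g \<otimes>\<^bsub>G\<^esub> (inv\<^bsub>G\<^esub> g \<otimes>\<^bsub>G\<^esub> h) = h" using g h(1) by (simp flip: G.m_assoc)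
  ultimately have "x = (i, (g \<otimes>\<^bsub>G\<^esub> (inv\<^bsub>G\<^esub> g \<otimes>\<^bsub>G\<^esub> h)) <#\<^bsub>G\<^esub> H i) \<and> i \<in> I - J \<and>
      inv\<^bsub>G\<^esub> g \<otimes>\<^bsub>G\<^esub> h \<in> P J"
    using xi(1,2) C by simp
  then show "x \<in> ?E" by blast
next
  fix x assume "x \<in> ?E"
  then obtain i p where x: "x = (i, (g \<otimes>\<^bsub>G\<^esub> p) <#\<^bsub>G\<^esub> H i)" "i \<in> I" "i \<notin> J" "p \<in> P J" by blast
  then have p: "p \<in> carrier G" by (simp add: parabolic_def)
  have "g \<otimes>\<^bsub>G\<^esub> p \<in> (g <#\<^bsub>G\<^esub> H j)" if "j \<in> J" for j
    using that x(4) g by (auto simp: l_coset_def parabolic_def)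
  moreover have "g \<otimes>\<^bsub>G\<^esub> p \<in> snd x"
    using x coset_self g p by simp
  ultimately show "x \<in> elements (residue S (std g J))"
    using x g p by (auto simp: residue_def incidence_system_of_def std_flag_def coset_in_lcosets)
qed

text \<open>Two incident cosets with representatives in the translate of \<open>P J\<close> by
  \<open>g\<close> form a flag together with \<open>std g J\<close>. A common element of that flag
  is \<open>g\<close> times the required \<open>r\<close>, so both cosets get the same
  representative.\<close>

lemma residue_incident:
  assumes g: "g \<in> carrier G" and J: "J \<subseteq> I" and ik: "i \<in> I" "k \<in> I" and pq: "p \<in> P J" "q \<in> P J"
    and inc: "((g \<otimes>\<^bsub>G\<^esub> p) <#\<^bsub>G\<^esub> H i) \<inter> ((g \<otimes>\<^bsub>G\<^esub> q) <#\<^bsub>G\<^esub> H k) \<noteq> {}"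
  shows "\<exists>r\<in>P J. inv\<^bsub>G\<^esub> p \<otimes>\<^bsub>G\<^esub> r \<in> H i \<and> inv\<^bsub>G\<^esub> q \<otimes>\<^bsub>G\<^esub> r \<in> H k"
proof -
  let ?x = "(i, (g \<otimes>\<^bsub>G\<^esub> p) <#\<^bsub>G\<^esub> H i)" and ?y = "(k, (g \<otimes>\<^bsub>G\<^esub> q) <#\<^bsub>G\<^esub> H k)"
  have pqG: "p \<in> carrier G" "q \<in> carrier G" using pq by (auto simp: parabolic_def)
  have el: "(l, (g \<otimes>\<^bsub>G\<^esub> s) <#\<^bsub>G\<^esub> H l) \<in> elements S" if "s \<in> P J" "l \<in> I" for l s
    using that g by (auto simp: incidence_system_of_def parabolic_def coset_in_lcosets)
  have meet: "((g \<otimes>\<^bsub>G\<^esub> s) <#\<^bsub>G\<^esub> H l) \<inter> snd z \<noteq> {}"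
    if "z \<in> std g J" "s \<in> P J" "l \<in> I" for l s z
  proof -
    have "g \<otimes>\<^bsub>G\<^esub> s \<in> snd z" "s \<in> carrier G"
      using that(1,2) by (auto simp: l_coset_def parabolic_def std_flag_def intro!: bexI[of _ s])
    then show ?thesis using coset_self[OF that(3), of "g \<otimes>\<^bsub>G\<^esub> s"] g by blast
  qed
  have "flag S (insert ?y (std g J))"
    using flag_std[OF g J] el meet ik pq by (intro flag_insert) auto
  then have "flag S (insert ?x (insert ?y (std g J)))"
  proof (rule flag_insert)
    show "?x \<in> elements S" using el ik pq by blast
    show "snd ?x \<inter> snd z \<noteq> {}" if "z \<in> insert ?y (std g J)" for z
      using that inc meet[OF _ pq(1) ik(1), of z] by (metis insertE snd_conv)
  qed
  then obtain h where h: "h \<in> carrier G" "\<And>z. z \<in> insert ?x (insert ?y (std g J)) \<Longrightarrow> h \<in> snd z"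
    using flag_common_element by metis
  let ?r = "inv\<^bsub>G\<^esub> g \<otimes>\<^bsub>G\<^esub> h"
  have "?r \<in> P J"
    unfolding parabolic_def
  proof (intro CollectI conjI ballI)
    show "?r \<in> H j" if "j \<in> J" for j
      using h(1) h(2)[of "(j, g <#\<^bsub>G\<^esub> H j)"] that J g coset_mem_iff[of j g h]
      by (auto simp: std_flag_def)
  qed (use g h in simp)
  moreover have gr: "g \<otimes>\<^bsub>G\<^esub> ?r = h" using g h(1) by (simp flip: G.m_assoc)
  have "inv\<^bsub>G\<^esub> p \<otimes>\<^bsub>G\<^esub> ?r \<in> H i"
    using coset_mem_iff[OF ik(1), of "g \<otimes>\<^bsub>G\<^esub> p" "g \<otimes>\<^bsub>G\<^esub> ?r"] cancel_left[OF g pqG(1), of ?r]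
      h(1) h(2)[of ?x] g pqG gr
    by simp
  moreover have "inv\<^bsub>G\<^esub> q \<otimes>\<^bsub>G\<^esub> ?r \<in> H k"
    using coset_mem_iff[OF ik(2), of "g \<otimes>\<^bsub>G\<^esub> q" "g \<otimes>\<^bsub>G\<^esub> ?r"] cancel_left[OF g pqG(2), of ?r]
      h(1) h(2)[of ?y] g pqG gr
    by simp
  ultimately show ?thesis by blast
qed

text \<open>Walks in the residue correspond to products of elements of the subgroups
  \<open>P (insert i J)\<close>. Leaving a coset of type \<open>k\<close> changes its representative
  by a factor in \<open>P (insert k J)\<close>; conversely, such a factor does not change the coset
  of type \<open>k\<close>, so it can be absorbed by a detour through type \<open>k\<close>. Since
  \<open>J\<close> is not all of \<open>I\<close>, there is a type to start from.\<close>

lemma connected_residue_iff: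
  assumes g: "g \<in> carrier G" and J: "J \<subseteq> I" and ne: "J \<noteq> I"
  shows "connected_incidence_graph (residue S (std g J)) \<longleftrightarrow>
    P J \<subseteq> generate G (\<Union>i\<in>I - J. P (insert i J))"
proof
  let ?R = "residue S (std g J)"
  let ?e = "{(u, v). u \<in> elements ?R \<and> v \<in> elements ?R \<and> u \<noteq> v \<and> incident ?R u v}"
  let ?U = "\<Union>i\<in>I - J. P (insert i J)"
  let ?c = "\<lambda>i p. (i, (g \<otimes>\<^bsub>G\<^esub> p) <#\<^bsub>G\<^esub> H i)"
  have PJ: "subgroup (P J) G" using J by (rule parabolic_subgroup)
  have UP: "?U \<subseteq> P J" by (auto simp: parabolic_def)
  have genP: "generate G ?U \<subseteq> P J" using UP PJ by (rule G.generate_subgroup_incl)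
  have Ucl: "?U \<subseteq> carrier G" by (auto simp: parabolic_def)
  have insJ: "p \<in> generate G ?U" if "p \<in> P J" "p \<in> H i" "i \<in> I - J" for p i
    using that by (intro generate.incl) (auto simp: parabolic_def)
  note PG = subgroup.mem_carrier[OF PJ]
  {
    assume con: "connected_incidence_graph ?R"
    obtain i where i: "i \<in> I - J" using J ne by blast
    \<comment> \<open>Invariant of a walk from the coset of type \<open>i\<close> through
      \<open>g\<close>: each coset reached has a representative \<open>g\<close> times an element of
      the generated subgroup.\<close>
    have inv: "\<exists>k q. v = ?c k q \<and> k \<in> I - J \<and> q \<in> generate G ?U"
      if "(?c i \<one>\<^bsub>G\<^esub>, v) \<in> ?e\<^sup>*" for v
      using that
    proof (induction rule: rtrancl_induct)
      case base
      then show ?case using i generate.one[of G ?U] by blast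
    next
      case (step u v)
      then obtain k q where k: "u = ?c k q" "k \<in> I - J" "q \<in> generate G ?U" by blast
      obtain l t where l: "v = ?c l t" "l \<in> I - J" "t \<in> P J"
        using step(2) residue_elements[OF g J] by auto
      have "(snd u) \<inter> (snd v) \<noteq> {}"
        using step(2) by (auto simp: residue_def incidence_system_of_def)
      then obtain r where r: "r \<in> P J" "inv\<^bsub>G\<^esub> q \<otimes>\<^bsub>G\<^esub> r \<in> H k" "inv\<^bsub>G\<^esub> t \<otimes>\<^bsub>G\<^esub> r \<in> H l"
        using residue_incident[OF g J, of k l q t] k l genP by auto
      have qP: "q \<in> P J" using k(3) genP by blast
      have "inv\<^bsub>G\<^esub> q \<otimes>\<^bsub>G\<^esub> r \<in> generate G ?U"
        using r k(2) qP PJ by (intro insJ[of _ k]) (auto simp: subgroup.m_closed subgroup.m_inv_closed)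
      then have "q \<otimes>\<^bsub>G\<^esub> (inv\<^bsub>G\<^esub> q \<otimes>\<^bsub>G\<^esub> r) \<in> generate G ?U"
        using k(3) by (rule generate.eng[rotated])
      then have "r \<in> generate G ?U"
        using PG[OF qP] PG[OF r(1)] by (simp flip: G.m_assoc)
      moreover have "v = ?c l r"
        using l r(3) g PG[OF l(3)] PG[OF r(1)]
        by (simp add: coset_eq_iff cancel_left)
      ultimately show ?case using l(2) by blast
    qed
    show "P J \<subseteq> generate G ?U"
    proof
      fix p assume p: "p \<in> P J"
      have "?c i \<one>\<^bsub>G\<^esub> \<in> elements ?R" "?c i p \<in> elements ?R"
        using residue_elements[OF g J] i p subgroup.one_closed[OF PJ] by blast+
      then have "(?c i \<one>\<^bsub>G\<^esub>, ?c i p) \<in> ?e\<^sup>*"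
        using con unfolding connected_incidence_graph_def by blast
      then obtain q where q: "?c i p = ?c i q" "q \<in> generate G ?U" using inv by blast
      have qP: "q \<in> P J" using q(2) genP by blast
      have "inv\<^bsub>G\<^esub> q \<otimes>\<^bsub>G\<^esub> p \<in> H i"
        using q(1)[symmetric] i g PG[OF p] PG[OF qP] by (simp add: coset_eq_iff cancel_left)
      then have "inv\<^bsub>G\<^esub> q \<otimes>\<^bsub>G\<^esub> p \<in> generate G ?U"
        using p qP PJ i by (intro insJ[of _ i]) (auto simp: subgroup.m_closed subgroup.m_inv_closed)
      then have "q \<otimes>\<^bsub>G\<^esub> (inv\<^bsub>G\<^esub> q \<otimes>\<^bsub>G\<^esub> p) \<in> generate G ?U"
        using q(2) by (rule generate.eng[rotated])
      then show "p \<in> generate G ?U"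
        using PG[OF p] PG[OF qP] by (simp flip: G.m_assoc)
    qed
  }
  {
    assume gen: "P J \<subseteq> generate G ?U"
    \<comment> \<open>Cosets through the same element meet, so they are equal or adjacent.\<close>
    have same: "(?c i p, ?c k p) \<in> ?e\<^sup>*" if "p \<in> P J" "i \<in> I - J" "k \<in> I - J" for i k p
    proof (cases "i = k")
      case False
      have "?c i p \<in> elements ?R" "?c k p \<in> elements ?R"
        using residue_elements[OF g J] that by blast+
      moreover have "incident ?R (?c i p) (?c k p)"
        using coset_self[of _ "g \<otimes>\<^bsub>G\<^esub> p"] g PG[OF that(1)] that
        by (auto simp: residue_def incidence_system_of_def)
      ultimately show ?thesis using False by (intro r_into_rtrancl) auto
    qed auto
    \<comment> \<open>As \<open>s\<close> lies in \<open>H l\<close>, the cosets of type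
      \<open>l\<close> for \<open>p\<close> and for \<open>p \<otimes> s\<close> coincide; the walk
      goes from type \<open>i\<close> to type \<open>l\<close> and on to type
      \<open>k\<close>.\<close>
    have one_step: "(?c i p, ?c k (p \<otimes>\<^bsub>G\<^esub> s)) \<in> ?e\<^sup>*"
      if s: "s \<in> P J" "s \<in> H l" "l \<in> I - J" and "p \<in> P J" "i \<in> I - J" "k \<in> I - J" for i k l p s
    proof -
      have ps: "p \<in> carrier G" "s \<in> carrier G" using PG that(1,4) by blast+
      have "inv\<^bsub>G\<^esub> p \<otimes>\<^bsub>G\<^esub> (p \<otimes>\<^bsub>G\<^esub> s) = s"
        using ps by (simp flip: G.m_assoc)
      then have eq: "?c l p = ?c l (p \<otimes>\<^bsub>G\<^esub> s)"
        using g ps s(2,3) by (simp add: coset_eq_iff cancel_left)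
      have "(?c i p, ?c l p) \<in> ?e\<^sup>*" using that(4,5,3) by (rule same)
      moreover have "(?c l (p \<otimes>\<^bsub>G\<^esub> s), ?c k (p \<otimes>\<^bsub>G\<^esub> s)) \<in> ?e\<^sup>*"
        using subgroup.m_closed[OF PJ that(4,1)] that(3,6) by (rule same)
      ultimately show ?thesis unfolding eq by (rule rtrancl_trans)
    qed
    \<comment> \<open>Quantifying over \<open>p\<close> allows the walk for the second factor of a
      product to start where the walk for the first one ends.\<close>
    have path: "\<forall>p\<in>P J. \<forall>i\<in>I - J. \<forall>k\<in>I - J. (?c i p, ?c k (p \<otimes>\<^bsub>G\<^esub> s)) \<in> ?e\<^sup>*"
      if "s \<in> generate G ?U" for s
      using that
    proof (induction rule: generate.induct)
      case one
      show ?case using same PG by simp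
    next
      case (incl s)
      then show ?case using one_step[of s] UP by (fastforce simp: parabolic_def)
    next
      case (inv s)
      then obtain l where l: "l \<in> I - J" "s \<in> P (insert l J)" by blast
      then have "inv\<^bsub>G\<^esub> s \<in> P (insert l J)"
        using parabolic_subgroup[of "insert l J"] J by (auto intro: subgroup.m_inv_closed)
      then show ?case using one_step[of "inv\<^bsub>G\<^esub> s" l] l(1) by (fastforce simp: parabolic_def)
    next
      case (eng s t)
      show ?case
      proof (intro ballI)
        fix p i k assume *: "p \<in> P J" "i \<in> I - J" "k \<in> I - J"
        have st: "s \<in> P J" "t \<in> P J" using eng.hyps genP by blast+
        have assoc: "p \<otimes>\<^bsub>G\<^esub> (s \<otimes>\<^bsub>G\<^esub> t) = p \<otimes>\<^bsub>G\<^esub> s \<otimes>\<^bsub>G\<^esub> t"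
          using PG *(1) st by (simp add: G.m_assoc)
        have "(?c i p, ?c i (p \<otimes>\<^bsub>G\<^esub> s)) \<in> ?e\<^sup>*"
          using eng.IH(1)[rule_format, OF *(1,2,2)] .
        moreover have "(?c i (p \<otimes>\<^bsub>G\<^esub> s), ?c k (p \<otimes>\<^bsub>G\<^esub> s \<otimes>\<^bsub>G\<^esub> t)) \<in> ?e\<^sup>*"
          using eng.IH(2)[rule_format, OF subgroup.m_closed[OF PJ *(1) st(1)] *(2,3)] .
        ultimately show "(?c i p, ?c k (p \<otimes>\<^bsub>G\<^esub> (s \<otimes>\<^bsub>G\<^esub> t))) \<in> ?e\<^sup>*"
          unfolding assoc by (rule rtrancl_trans)
      qed
    qed
    show "connected_incidence_graph ?R"
      unfolding connected_incidence_graph_def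
    proof (intro ballI)
      fix x y assume "x \<in> elements ?R" "y \<in> elements ?R"
      then obtain i p k q where x: "x = ?c i p" "i \<in> I - J" "p \<in> P J"
        and y: "y = ?c k q" "k \<in> I - J" "q \<in> P J"
        unfolding residue_elements[OF g J] by blast
      have "inv\<^bsub>G\<^esub> p \<otimes>\<^bsub>G\<^esub> q \<in> generate G ?U"
        using gen subgroup.m_closed[OF PJ subgroup.m_inv_closed[OF PJ x(3)] y(3)] by (rule subsetD)
      note path[OF this, rule_format, OF x(3,2) y(2)]
      moreover have "p \<otimes>\<^bsub>G\<^esub> (inv\<^bsub>G\<^esub> p \<otimes>\<^bsub>G\<^esub> q) = q"
        using PG[OF x(3)] PG[OF y(3)] by (simp flip: G.m_assoc)
      ultimately show "(x, y) \<in> ?e\<^sup>*"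
        unfolding x(1) y(1) by (simp only:)
    qed
  }
qed

text \<open>Every flag has the form \<open>std g J\<close>, its residue has rank
  \<open>card (I - J)\<close>, and the connectedness criterion for that residue does not depend on
  \<open>g\<close>.\<close>

lemma residually_connected_iff:
  "residually_connected S \<longleftrightarrow> (\<forall>J\<subseteq>I. 2 \<le> card (I - J) \<longrightarrow>
     P J \<subseteq> generate G (\<Union>i\<in>I - J. P (insert i J)))"
proof -
  have rank: "rank (residue S (std g J)) = card (I - J)" for g J
    using flag_type_std[of g J] by (simp add: rank_def residue_def) (simp add: incidence_system_of_def)
  have ne: "J \<noteq> I" if "2 \<le> card (I - J)" for J using that by auto
  show ?thesis
  proof
    assume rc: "residually_connected S"
    show "\<forall>J\<subseteq>I. 2 \<le> card (I - J) \<longrightarrow> P J \<subseteq> generate G (\<Union>i\<in>I - J. P (insert i J))"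
      using rc flag_std[OF G.one_closed] rank connected_residue_iff[OF G.one_closed] ne
      unfolding residually_connected_def by metis
  next
    assume gen: "\<forall>J\<subseteq>I. 2 \<le> card (I - J) \<longrightarrow> P J \<subseteq> generate G (\<Union>i\<in>I - J. P (insert i J))"
    show "residually_connected S"
      unfolding residually_connected_def
    proof (intro allI impI, elim conjE)
      fix F assume F: "flag S F" "2 \<le> rank (residue S F)"
      from F(1) obtain g J where gJ: "g \<in> carrier G" "J \<subseteq> I" "F = std g J" by (rule flag_eq_std)
      then show "connected_incidence_graph (residue S F)"
        using gen F(2) rank ne connected_residue_iff[OF gJ(1,2)] by metis
    qed
  qed
qed

text \<open>A flag of corank one misses exactly one type \<open>i\<close>. Its residue consists of
  cosets of type \<open>i\<close> represented by \<open>g\<close> times elements of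
  \<open>P (I - {i})\<close>, and these all coincide exactly if \<open>P (I - {i})\<close> lies in
  \<open>H i\<close>.\<close>

lemma firm_iff:
  assumes fin: "finite I"
  shows "firm S \<longleftrightarrow> (\<forall>i\<in>I. \<not> P (I - {i}) \<subseteq> H i)"
proof -
  have card: "card (std g J) = card J" for g J
    by (simp add: std_flag_def card_image inj_on_def)
  have corank: "corank S (std g J) = card I - card J" for g J
    by (simp add: corank_def rank_def card) (simp add: incidence_system_of_def)
  have two: "(\<exists>x\<in>elements (residue S (std g (I - {i}))). \<exists>y\<in>elements (residue S (std g (I - {i}))). x \<noteq> y)
      \<longleftrightarrow> \<not> P (I - {i}) \<subseteq> H i" if g: "g \<in> carrier G" and i: "i \<in> I" for g i
  proof -
    have J: "I - {i} \<subseteq> I" by blast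
    let ?P = "P (I - {i})"
    have PJ: "subgroup ?P G" using J by (rule parabolic_subgroup)
    note PG = subgroup.mem_carrier[OF PJ]
    have el: "elements (residue S (std g (I - {i}))) = {(i, (g \<otimes>\<^bsub>G\<^esub> p) <#\<^bsub>G\<^esub> H i) | p. p \<in> ?P}"
      unfolding residue_elements[OF g J] using i by auto
    have eq: "(i, (g \<otimes>\<^bsub>G\<^esub> p) <#\<^bsub>G\<^esub> H i) = (i, (g \<otimes>\<^bsub>G\<^esub> q) <#\<^bsub>G\<^esub> H i) \<longleftrightarrow> inv\<^bsub>G\<^esub> p \<otimes>\<^bsub>G\<^esub> q \<in> H i"
      if "p \<in> ?P" "q \<in> ?P" for p q
      using that PG g i by (simp add: coset_eq_iff cancel_left)
    show ?thesis
    proof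
      assume "\<exists>x\<in>elements (residue S (std g (I - {i}))). \<exists>y\<in>elements (residue S (std g (I - {i}))). x \<noteq> y"
      then obtain p q where "p \<in> ?P" "q \<in> ?P" "inv\<^bsub>G\<^esub> p \<otimes>\<^bsub>G\<^esub> q \<notin> H i"
        unfolding el using eq by blast
      moreover have "inv\<^bsub>G\<^esub> p \<otimes>\<^bsub>G\<^esub> q \<in> ?P"
        using calculation PJ by (simp add: subgroup.m_closed subgroup.m_inv_closed)
      ultimately show "\<not> ?P \<subseteq> H i" by blast
    next
      assume "\<not> ?P \<subseteq> H i"
      then obtain p where p: "p \<in> ?P" "p \<notin> H i" by blast
      \<comment> \<open>The two elements are the cosets of type \<open>i\<close> through
        \<open>g\<close> and through \<open>g \<otimes> p\<close>.\<close>
      then show "\<exists>x\<in>elements (residue S (std g (I - {i}))). \<exists>y\<in>elements (residue S (std g (I - {i}))). x \<noteq> y"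
        unfolding el using eq[OF subgroup.one_closed[OF PJ] p(1)] PG[OF p(1)] subgroup.one_closed[OF PJ] p
        by auto
    qed
  qed
  show ?thesis
  proof
    assume f: "firm S"
    show "\<forall>i\<in>I. \<not> P (I - {i}) \<subseteq> H i"
    proof
      fix i assume i: "i \<in> I"
      \<comment> \<open>Needed because \<open>corank\<close> uses truncated subtraction, which would
        yield zero for an empty type set.\<close>
      have "0 < card I" using i fin by (auto simp: card_gt_0_iff)
      then have "corank S (std \<one>\<^bsub>G\<^esub> (I - {i})) = 1"
        using i fin by (simp add: corank card_Diff_singleton)
      then show "\<not> P (I - {i}) \<subseteq> H i"
        using f[unfolded firm_def, rule_format, of "std \<one>\<^bsub>G\<^esub> (I - {i})"] two[OF G.one_closed i]
          flag_std[OF G.one_closed, of "I - {i}"] by simp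
    qed
  next
    assume c: "\<forall>i\<in>I. \<not> P (I - {i}) \<subseteq> H i"
    show "firm S"
      unfolding firm_def
    proof (intro allI impI, elim conjE)
      fix F assume F: "flag S F" "corank S F = 1"
      from F(1) obtain g J where gJ: "g \<in> carrier G" "J \<subseteq> I" "F = std g J" by (rule flag_eq_std)
      have "card (I - J) = 1"
        using F(2) gJ fin by (simp add: corank card_Diff_subset finite_subset)
      then obtain i where "I - J = {i}" by (auto simp: card_1_singleton_iff)
      then have "i \<in> I" "J = I - {i}" using gJ(2) by blast+
      then show "\<exists>x\<in>elements (residue S F). \<exists>y\<in>elements (residue S F). x \<noteq> y"
        using two[OF gJ(1), of i] c gJ(3) by simp
    qed
  qed
qed

end

section \<open>Flags and residues of a free product\<close>

text \<open>The assumptions are symmetric in the two factors (lemma \<open>swap\<close>), unlike the type of reduced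
  words, so that it suffices to prove each fact for the left factor.\<close>

locale free_product_sys =
  A: flag_transitive_sys \<alpha> + B: flag_transitive_sys \<beta> + G: coset_sys \<gamma>
  for \<alpha> :: "('a, 'i) coset_system" and \<beta> :: "('b, 'i) coset_system"
    and \<gamma> :: "('g, 'i) coset_system" +
  fixes e :: "'a \<Rightarrow> 'g" and f :: "'b \<Rightarrow> 'g"
    and la :: "'g \<Rightarrow> 'a set" and lb :: "'g \<Rightarrow> 'b set"
    and W :: "'a set \<Rightarrow> 'b set \<Rightarrow> 'g set"
  assumes W_def: "W X Y = {w \<in> carrier (cs_group \<gamma>). la w \<subseteq> X \<and> lb w \<subseteq> Y}"
    and finite_types: "finite (cs_types \<alpha>)" "finite (cs_types \<beta>)"
    and disjoint_types: "cs_types \<alpha> \<inter> cs_types \<beta> = {}"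
    and types: "cs_types \<gamma> = cs_types \<alpha> \<union> cs_types \<beta>"
    and subgroup_left: "i \<in> cs_types \<alpha> \<Longrightarrow>
      cs_subgroup \<gamma> i = W (cs_subgroup \<alpha> i) (carrier (cs_group \<beta>))"
    and subgroup_right: "i \<in> cs_types \<beta> \<Longrightarrow>
      cs_subgroup \<gamma> i = W (carrier (cs_group \<alpha>)) (cs_subgroup \<beta> i)"
    and e_hom: "e \<in> hom (cs_group \<alpha>) (cs_group \<gamma>)"
    and f_hom: "f \<in> hom (cs_group \<beta>) (cs_group \<gamma>)"
    and letters_carrier: "w \<in> carrier (cs_group \<gamma>) \<Longrightarrow> la w \<subseteq> carrier (cs_group \<alpha>)"
      "w \<in> carrier (cs_group \<gamma>) \<Longrightarrow> lb w \<subseteq> carrier (cs_group \<beta>)"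
    and letters_e: "la (e a) = {a} - {\<one>\<^bsub>cs_group \<alpha>\<^esub>}" "lb (e a) = {}"
    and letters_f: "la (f b) = {}" "lb (f b) = {b} - {\<one>\<^bsub>cs_group \<beta>\<^esub>}"
    and W_subgroup: "subgroup X (cs_group \<alpha>) \<Longrightarrow> subgroup Y (cs_group \<beta>) \<Longrightarrow>
      subgroup (W X Y) (cs_group \<gamma>)"
    and W_least: "subgroup X (cs_group \<alpha>) \<Longrightarrow> subgroup Y (cs_group \<beta>) \<Longrightarrow>
      subgroup K (cs_group \<gamma>) \<Longrightarrow> e ` X \<subseteq> K \<Longrightarrow> f ` Y \<subseteq> K \<Longrightarrow> W X Y \<subseteq> K"
    and coset_prefix_left: "subgroup X (cs_group \<alpha>) \<Longrightarrow> t \<in> carrier (cs_group \<gamma>) \<Longrightarrow> \<not> la t \<subseteq> X \<Longrightarrow>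
      \<exists>u\<in>carrier (cs_group \<gamma>). \<exists>a\<in>carrier (cs_group \<alpha>). \<exists>w\<in>W X (carrier (cs_group \<beta>)).
        t = u \<otimes>\<^bsub>cs_group \<gamma>\<^esub> e a \<otimes>\<^bsub>cs_group \<gamma>\<^esub> w \<and>
        (\<forall>h\<in>W X (carrier (cs_group \<beta>)). \<exists>c\<in>X.
           let v = u \<otimes>\<^bsub>cs_group \<gamma>\<^esub> e a \<otimes>\<^bsub>cs_group \<gamma>\<^esub> h in
           insert (a \<otimes>\<^bsub>cs_group \<alpha>\<^esub> c) (la u) \<subseteq> la v \<and> lb u \<subseteq> lb v)"
    and coset_prefix_right: "subgroup Y (cs_group \<beta>) \<Longrightarrow> t \<in> carrier (cs_group \<gamma>) \<Longrightarrow> \<not> lb t \<subseteq> Y \<Longrightarrow>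
      \<exists>u\<in>carrier (cs_group \<gamma>). \<exists>b\<in>carrier (cs_group \<beta>). \<exists>w\<in>W (carrier (cs_group \<alpha>)) Y.
        t = u \<otimes>\<^bsub>cs_group \<gamma>\<^esub> f b \<otimes>\<^bsub>cs_group \<gamma>\<^esub> w \<and>
        (\<forall>h\<in>W (carrier (cs_group \<alpha>)) Y. \<exists>c\<in>Y.
           let v = u \<otimes>\<^bsub>cs_group \<gamma>\<^esub> f b \<otimes>\<^bsub>cs_group \<gamma>\<^esub> h in
           la u \<subseteq> la v \<and> insert (b \<otimes>\<^bsub>cs_group \<beta>\<^esub> c) (lb u) \<subseteq> lb v)"
begin

lemma swap: "free_product_sys \<beta> \<alpha> \<gamma> f e lb la (\<lambda>Y X. W X Y)"
proof (intro free_product_sys.intro free_product_sys_axioms.intro)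
  show "flag_transitive_sys \<beta>" "flag_transitive_sys \<alpha>" "coset_sys \<gamma>" by unfold_locales
  show "cs_types \<beta> \<inter> cs_types \<alpha> = {}" using disjoint_types by blast
  show "cs_types \<gamma> = cs_types \<beta> \<union> cs_types \<alpha>" using types by blast
  show "W Y X = {w \<in> carrier (cs_group \<gamma>). lb w \<subseteq> X \<and> la w \<subseteq> Y}" for X Y
    unfolding W_def by blast
  show "W Y X \<subseteq> K" if "subgroup X (cs_group \<beta>)" "subgroup Y (cs_group \<alpha>)" "subgroup K (cs_group \<gamma>)"
    "f ` X \<subseteq> K" "e ` Y \<subseteq> K" for X Y K
    using W_least that by blast
  show "subgroup (W Y X) (cs_group \<gamma>)" if "subgroup X (cs_group \<beta>)" "subgroup Y (cs_group \<alpha>)" for X Y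
    using W_subgroup that by blast
next
  fix X t
  assume "subgroup X (cs_group \<beta>)" "t \<in> carrier (cs_group \<gamma>)" "\<not> lb t \<subseteq> X"
  from coset_prefix_right[OF this] show "\<exists>u\<in>carrier (cs_group \<gamma>). \<exists>b\<in>carrier (cs_group \<beta>). \<exists>w\<in>W (carrier (cs_group \<alpha>)) X.
        t = u \<otimes>\<^bsub>cs_group \<gamma>\<^esub> f b \<otimes>\<^bsub>cs_group \<gamma>\<^esub> w \<and>
        (\<forall>h\<in>W (carrier (cs_group \<alpha>)) X. \<exists>c\<in>X.
           let v = u \<otimes>\<^bsub>cs_group \<gamma>\<^esub> f b \<otimes>\<^bsub>cs_group \<gamma>\<^esub> h in
           insert (b \<otimes>\<^bsub>cs_group \<beta>\<^esub> c) (lb u) \<subseteq> lb v \<and> la u \<subseteq> la v)"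
    by (simp only: Let_def conj_commute)
next
  fix Y t
  assume "subgroup Y (cs_group \<alpha>)" "t \<in> carrier (cs_group \<gamma>)" "\<not> la t \<subseteq> Y"
  from coset_prefix_left[OF this] show "\<exists>u\<in>carrier (cs_group \<gamma>). \<exists>a\<in>carrier (cs_group \<alpha>). \<exists>w\<in>W Y (carrier (cs_group \<beta>)).
        t = u \<otimes>\<^bsub>cs_group \<gamma>\<^esub> e a \<otimes>\<^bsub>cs_group \<gamma>\<^esub> w \<and>
        (\<forall>h\<in>W Y (carrier (cs_group \<beta>)). \<exists>c\<in>Y.
           let v = u \<otimes>\<^bsub>cs_group \<gamma>\<^esub> e a \<otimes>\<^bsub>cs_group \<gamma>\<^esub> h in
           lb u \<subseteq> lb v \<and> insert (a \<otimes>\<^bsub>cs_group \<alpha>\<^esub> c) (la u) \<subseteq> la v)"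
    by (simp only: Let_def conj_commute)
qed (fact finite_types subgroup_left subgroup_right e_hom f_hom letters_carrier letters_e letters_f)+

text \<open>The only possible letter of \<open>e a\<close> is \<open>a\<close>; the identity has no
  letter, but it lies in every subgroup. Membership in sets of words can thus be tested inside the
  factor.\<close>

lemma e_mem_W: "subgroup X A.G \<Longrightarrow> a \<in> carrier A.G \<Longrightarrow> e a \<in> W X Y \<longleftrightarrow> a \<in> X"
  using hom_in_carrier[OF e_hom, of a] subgroup.one_closed[of X A.G]
  by (auto simp: W_def letters_e)

lemma W_mono: "X \<subseteq> X' \<Longrightarrow> Y \<subseteq> Y' \<Longrightarrow> W X Y \<subseteq> W X' Y'"
  by (auto simp: W_def)

text \<open>Each \<open>G.H j\<close> restricts the letters from one factor only, so intersecting
  these subgroups intersects the allowed letters separately in each factor.\<close>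

lemma parabolic_eq:
  assumes "J \<subseteq> G.I"
  shows "G.P J = W (A.P (J \<inter> A.I)) (B.P (J \<inter> B.I))"
proof (intro equalityI subsetI)
  fix w assume w: "w \<in> G.P J"
  then have wG: "w \<in> carrier G.G" by (simp add: parabolic_def)
  have "la w \<subseteq> A.H j" if "j \<in> J" "j \<in> A.I" for j
    using w that subgroup_left[of j] by (auto simp: parabolic_def W_def)
  moreover have "lb w \<subseteq> B.H j" if "j \<in> J" "j \<in> B.I" for j
    using w that subgroup_right[of j] by (auto simp: parabolic_def W_def)
  ultimately show "w \<in> W (A.P (J \<inter> A.I)) (B.P (J \<inter> B.I))"
    using wG letters_carrier[OF wG] by (auto simp: parabolic_def W_def)
next
  fix w assume w: "w \<in> W (A.P (J \<inter> A.I)) (B.P (J \<inter> B.I))"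
  then have wG: "w \<in> carrier G.G" by (simp add: W_def)
  have "w \<in> G.H j" if "j \<in> J" for j
  proof (cases "j \<in> A.I")
    case True
    then show ?thesis
      using w that wG letters_carrier(2)[OF wG] by (auto simp: subgroup_left W_def parabolic_def)
  next
    case False
    then have "j \<in> B.I" using that assms types by blast
    then show ?thesis
      using w that wG letters_carrier(1)[OF wG] by (auto simp: subgroup_right W_def parabolic_def)
  qed
  then show "w \<in> G.P J" using wG by (simp add: parabolic_def)
qed

text \<open>The step that adds one coset to a standard flag. Outside the trivial case,
  \<open>t\<close> is replaced by the representative \<open>u \<otimes> e a\<close> given by the
  prefix property. Any word in the coset and in \<open>G.H k\<close> contains the letters of
  \<open>u\<close> and a letter from the coset of \<open>a\<close>. Hence \<open>u\<close> lies in
  \<open>G.H k\<close>, and what remains is a flag of \<alpha>.\<close>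

lemma meet_step_left:
  assumes i: "i \<in> A.I" and K: "K \<subseteq> G.I" and t: "t \<in> carrier G.G"
    and meet: "\<And>k. k \<in> K \<Longrightarrow> (t <#\<^bsub>G.G\<^esub> G.H i) \<inter> G.H k \<noteq> {}"
  shows "\<exists>r\<in>G.P K. r \<in> t <#\<^bsub>G.G\<^esub> G.H i"
proof (cases "la t \<subseteq> A.H i")
  case True
  have iG: "i \<in> G.I" using i types by blast
  have "t \<in> G.H i" using True t letters_carrier by (simp add: subgroup_left[OF i] W_def)
  then have "inv\<^bsub>G.G\<^esub> t \<in> G.H i" using G.subgroup_type[OF iG] by (rule subgroup.m_inv_closed[rotated])
  then have "\<one>\<^bsub>G.G\<^esub> \<in> t <#\<^bsub>G.G\<^esub> G.H i"
    using G.coset_mem_iff[OF iG t G.G.one_closed] t by simp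
  moreover have "\<one>\<^bsub>G.G\<^esub> \<in> G.P K" using G.parabolic_subgroup[OF K] by (rule subgroup.one_closed)
  ultimately show ?thesis by blast
next
  case False
  have iG: "i \<in> G.I" using i types by blast
  obtain u a w where u: "u \<in> carrier G.G" and a: "a \<in> carrier A.G" and w: "w \<in> G.H i"
    and tw: "t = u \<otimes>\<^bsub>G.G\<^esub> e a \<otimes>\<^bsub>G.G\<^esub> w"
    and prefix: "\<And>h. h \<in> G.H i \<Longrightarrow> \<exists>c\<in>A.H i.
      insert (a \<otimes>\<^bsub>A.G\<^esub> c) (la u) \<subseteq> la (u \<otimes>\<^bsub>G.G\<^esub> e a \<otimes>\<^bsub>G.G\<^esub> h) \<and>
      lb u \<subseteq> lb (u \<otimes>\<^bsub>G.G\<^esub> e a \<otimes>\<^bsub>G.G\<^esub> h)"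
    using coset_prefix_left[OF A.subgroup_type[OF i] t False]
    unfolding subgroup_left[OF i] Let_def by metis
  have eG: "e b \<in> carrier G.G" if "b \<in> carrier A.G" for b
    using hom_in_carrier[OF e_hom that] .
  have uea: "u \<otimes>\<^bsub>G.G\<^esub> e a \<in> carrier G.G" using u eG[OF a] by simp
  have "t \<in> (u \<otimes>\<^bsub>G.G\<^esub> e a) <#\<^bsub>G.G\<^esub> G.H i" using w by (auto simp: tw l_coset_def)
  then have coset: "t <#\<^bsub>G.G\<^esub> G.H i = (u \<otimes>\<^bsub>G.G\<^esub> e a) <#\<^bsub>G.G\<^esub> G.H i"
    using G.G.l_repr_independence[OF _ uea G.subgroup_type[OF iG]] by metis
  have hit: "\<exists>c\<in>A.H i. \<exists>v\<in>G.H k. insert (a \<otimes>\<^bsub>A.G\<^esub> c) (la u) \<subseteq> la v \<and> lb u \<subseteq> lb v"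
    if "k \<in> K" for k
    using meet[OF that] prefix unfolding coset by (fastforce simp: l_coset_def)
  \<comment> \<open>The letters of \<open>u\<close> all occur in some word of \<open>G.H k\<close>,
    and membership in \<open>G.H k\<close> is a condition on letters alone.\<close>
  have uP: "u \<in> G.H k" if "k \<in> K" for k
  proof (cases "k \<in> A.I")
    case True
    then show ?thesis
      using hit[OF that] u by (auto simp: subgroup_left W_def letters_carrier(2) dest: subset_trans)
  next
    case False
    then have "k \<in> B.I" using that K types by blast
    then show ?thesis
      using hit[OF that] u by (auto simp: subgroup_right W_def letters_carrier(1) dest: subset_trans)
  qed
  \<comment> \<open>By \<open>hit\<close>, the coset of \<open>a\<close> meets every
    \<open>A.H k\<close> with \<open>k\<close> in \<open>K\<close>, so adding it to the standard
    flag gives a flag of \<alpha>.\<close>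
  let ?F = "insert (i, a <#\<^bsub>A.G\<^esub> A.H i) (A.std \<one>\<^bsub>A.G\<^esub> (K \<inter> A.I))"
  have "flag A.S ?F"
  proof (rule A.flag_insert)
    show "flag A.S (A.std \<one>\<^bsub>A.G\<^esub> (K \<inter> A.I))" by (rule A.flag_std) auto
    show "(i, a <#\<^bsub>A.G\<^esub> A.H i) \<in> elements A.S"
      using i A.coset_in_lcosets[OF a] by (simp add: incidence_system_of_def)
    fix y assume "y \<in> A.std \<one>\<^bsub>A.G\<^esub> (K \<inter> A.I)"
    then obtain k where k: "k \<in> K" "k \<in> A.I" "y = (k, A.H k)"
      by (auto simp: std_flag_def A.G.lcos_mult_one subgroup.subset[OF A.subgroup_type])
    then obtain c where "c \<in> A.H i" "a \<otimes>\<^bsub>A.G\<^esub> c \<in> A.H k"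
      using hit[OF k(1)] by (auto simp: subgroup_left W_def)
    then show "snd (i, a <#\<^bsub>A.G\<^esub> A.H i) \<inter> snd y \<noteq> {}"
      unfolding k(3) by (auto simp: l_coset_def)
  qed
  then obtain b where b: "b \<in> carrier A.G" "\<And>x. x \<in> ?F \<Longrightarrow> b \<in> snd x"
    by (metis A.flag_common_element)
  have bH: "b \<in> A.H k" if "k \<in> K" "k \<in> A.I" for k
    using b(2)[of "(k, A.H k)"] that
    by (force simp: std_flag_def A.G.lcos_mult_one subgroup.subset[OF A.subgroup_type])
  obtain h where h: "h \<in> A.H i" "b = a \<otimes>\<^bsub>A.G\<^esub> h"
    using b(2)[of "(i, a <#\<^bsub>A.G\<^esub> A.H i)"] by (auto simp: l_coset_def)
  have hA: "h \<in> carrier A.G" using h(1) subgroup.subset[OF A.subgroup_type[OF i]] by blast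
  have ebH: "e b \<in> G.H k" if "k \<in> K" for k
  proof (cases "k \<in> A.I")
    case True
    then show ?thesis
      using bH[OF that True] e_mem_W[OF A.subgroup_type[OF True] b(1)] by (simp add: subgroup_left)
  next
    case False
    then have "k \<in> B.I" using that K types by blast
    then show ?thesis
      using eG[OF b(1)] b(1) by (auto simp: subgroup_right W_def letters_e)
  qed
  \<comment> \<open>The common element is \<open>u\<close> followed by the common element
    \<open>b\<close> of the flag of \<alpha>. Since \<open>b\<close> differs from \<open>a\<close>
    by a right factor \<open>h\<close> in \<open>A.H i\<close>, it stays in the coset.\<close>
  have "u \<otimes>\<^bsub>G.G\<^esub> e b \<in> G.P K"
    unfolding parabolic_def
    using u eG[OF b(1)] uP ebH subgroup.m_closed[OF G.subgroup_type] K by blast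
  moreover have "e h \<in> G.H i"
    using e_mem_W[OF A.subgroup_type[OF i] hA] h(1) by (simp add: subgroup_left[OF i])
  then have "u \<otimes>\<^bsub>G.G\<^esub> e b \<in> t <#\<^bsub>G.G\<^esub> G.H i"
    unfolding coset h(2) hom_mult[OF e_hom a hA]
    using u eG[OF a] eG[OF hA] by (auto simp: l_coset_def G.G.m_assoc[symmetric])
  ultimately show ?thesis by blast
qed

section \<open>Generation and firmness criteria in the factors and the product\<close>

text \<open>Adding all types of \<beta> to \<open>J\<close> leaves the same missing types. The
  generators in the product then only have letters from the subgroup \<open>?X\<close> generated in
  \<open>A.G\<close>, apart from letters of \<open>B.P B.I\<close>; hence \<open>e a\<close> can be
  generated only if \<open>a\<close> lies in \<open>?X\<close>.\<close>

lemma residual_left: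
  assumes gen: "\<forall>J\<subseteq>G.I. 2 \<le> card (G.I - J) \<longrightarrow>
      G.P J \<subseteq> generate G.G (\<Union>i\<in>G.I - J. G.P (insert i J))"
    and J: "J \<subseteq> A.I" "2 \<le> card (A.I - J)"
  shows "A.P J \<subseteq> generate A.G (\<Union>i\<in>A.I - J. A.P (insert i J))"
proof
  let ?X = "generate A.G (\<Union>i\<in>A.I - J. A.P (insert i J))"
  fix a assume a: "a \<in> A.P J"
  then have aA: "a \<in> carrier A.G" by (simp add: parabolic_def)
  let ?J = "J \<union> B.I"
  have J': "?J \<subseteq> G.I" using J types by blast
  have diff: "G.I - ?J = A.I - J" using types disjoint_types by blast
  have int: "?J \<inter> A.I = J" "?J \<inter> B.I = B.I" using J(1) disjoint_types by blast+
  have PB: "subgroup (B.P B.I) B.G" by (rule B.parabolic_subgroup) simp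
  have X: "subgroup ?X A.G" by (rule A.G.generate_is_subgroup) (auto simp: parabolic_def)
  have "G.P (insert i ?J) \<subseteq> W ?X (B.P B.I)" if i: "i \<in> A.I - J" for i
  proof -
    have "insert i ?J \<subseteq> G.I" "insert i ?J \<inter> A.I = insert i J" "insert i ?J \<inter> B.I = B.I"
      using i J' int disjoint_types types by blast+
    moreover have "A.P (insert i J) \<subseteq> ?X" using i by (auto intro: generate.incl)
    ultimately show ?thesis by (simp add: parabolic_eq W_mono)
  qed
  then have "generate G.G (\<Union>i\<in>G.I - ?J. G.P (insert i ?J)) \<subseteq> W ?X (B.P B.I)"
    unfolding diff by (intro G.G.generate_subgroup_incl W_subgroup X PB) blast
  then have "G.P ?J \<subseteq> W ?X (B.P B.I)"
    using gen[rule_format, OF J'] J(2) unfolding diff by blast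
  moreover have "e a \<in> G.P ?J"
    unfolding parabolic_eq[OF J'] int using e_mem_W[OF A.parabolic_subgroup[OF J(1)] aA] a by blast
  ultimately show "a \<in> ?X" using e_mem_W[OF X aA] by blast
qed

text \<open>If a type of \<beta> is missing from \<open>J\<close>, the image lies in a single
  generating subgroup and nothing has to be assumed about \<alpha>; this is why residues with types
  from both factors are connected. Otherwise only types of \<alpha> are missing, and
  \<open>e\<close> transports the generation from \<alpha>.\<close>

lemma image_e_left:
  assumes gen: "\<forall>J\<subseteq>A.I. 2 \<le> card (A.I - J) \<longrightarrow>
      A.P J \<subseteq> generate A.G (\<Union>i\<in>A.I - J. A.P (insert i J))"
    and J: "J \<subseteq> G.I" "2 \<le> card (G.I - J)"
  shows "e ` A.P (J \<inter> A.I) \<subseteq> generate G.G (\<Union>i\<in>G.I - J. G.P (insert i J))"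
proof -
  let ?U = "\<Union>i\<in>G.I - J. G.P (insert i J)"
  have emb: "e ` A.P (insert i J \<inter> A.I) \<subseteq> ?U" if i: "i \<in> G.I - J" for i
  proof -
    have iJ: "insert i J \<subseteq> G.I" using i J by blast
    have "subgroup (A.P (insert i J \<inter> A.I)) A.G" by (rule A.parabolic_subgroup) blast
    then have "e ` A.P (insert i J \<inter> A.I) \<subseteq> G.P (insert i J)"
      unfolding parabolic_eq[OF iJ] using e_mem_W by (auto simp: parabolic_def)
    then show ?thesis using i by blast
  qed
  show ?thesis
  proof (cases "\<exists>i\<in>G.I - J. i \<in> B.I")
    case True
    then obtain i where i: "i \<in> G.I - J" "i \<in> B.I" by blast
    \<comment> \<open>Adding a type of \<beta> does not shrink the part of the parabolic subgroup in
      \<open>A.G\<close>.\<close>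
    then have "insert i J \<inter> A.I = J \<inter> A.I" using disjoint_types by blast
    then have "e ` A.P (J \<inter> A.I) \<subseteq> ?U" using emb[OF i(1)] by simp
    then show ?thesis using generate.incl[of _ ?U G.G] by blast
  next
    case False
    then have diff: "G.I - J = A.I - J \<inter> A.I" using types by blast
    interpret eh: group_hom A.G G.G e
      by (intro group_hom.intro group_hom_axioms.intro A.G.is_group G.G.is_group e_hom)
    let ?V = "\<Union>i\<in>A.I - J \<inter> A.I. A.P (insert i (J \<inter> A.I))"
    have V: "?V \<subseteq> carrier A.G" by (auto simp: parabolic_def)
    have "e ` ?V \<subseteq> ?U"
    proof -
      have "e ` A.P (insert i (J \<inter> A.I)) \<subseteq> ?U" if "i \<in> A.I - J \<inter> A.I" for i
      proof -
        have "i \<in> G.I - J" "insert i J \<inter> A.I = insert i (J \<inter> A.I)" using that diff by blast+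
        then show ?thesis using emb by metis
      qed
      then show ?thesis by blast
    qed
    then have "e ` generate A.G ?V \<subseteq> generate G.G ?U"
      unfolding eh.generate_img[OF V, symmetric] by (rule G.G.mono_generate)
    moreover have "A.P (J \<inter> A.I) \<subseteq> generate A.G ?V"
      using gen[rule_format, of "J \<inter> A.I"] J(2) unfolding diff by simp
    ultimately show ?thesis by blast
  qed
qed

text \<open>Since \<open>G.H i\<close> allows every letter from \<open>B.G\<close>, the inclusion
  depends only on letters from \<open>A.G\<close>, and the words \<open>e a\<close> test it.\<close>

lemma firm_left:
  assumes i: "i \<in> A.I"
  shows "G.P (G.I - {i}) \<subseteq> G.H i \<longleftrightarrow> A.P (A.I - {i}) \<subseteq> A.H i"
proof -
  have I: "G.I - {i} \<subseteq> G.I" "(G.I - {i}) \<inter> A.I = A.I - {i}" "(G.I - {i}) \<inter> B.I = B.I"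
    using types disjoint_types i by blast+
  have "subgroup (A.P (A.I - {i})) A.G" by (rule A.parabolic_subgroup) blast
  note mem = e_mem_W[OF this] e_mem_W[OF A.subgroup_type[OF i]]
  have "A.P (A.I - {i}) \<subseteq> A.H i" if sub: "W (A.P (A.I - {i})) (B.P B.I) \<subseteq> W (A.H i) (carrier B.G)"
  proof
    fix a assume a: "a \<in> A.P (A.I - {i})"
    then have "a \<in> carrier A.G" by (simp add: parabolic_def)
    then show "a \<in> A.H i" using mem a sub by blast
  qed
  then show ?thesis
    unfolding parabolic_eq[OF I(1)] I(2,3) subgroup_left[OF i]
    using W_mono[of "A.P (A.I - {i})" "A.H i" "B.P B.I" "carrier B.G"]
    by (auto simp: parabolic_def)
qed

section \<open>Common elements of flags in the product\<close>

lemma meet_step: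
  assumes "i \<in> G.I" "K \<subseteq> G.I" "t \<in> carrier G.G"
    and "\<And>k. k \<in> K \<Longrightarrow> (t <#\<^bsub>G.G\<^esub> G.H i) \<inter> G.H k \<noteq> {}"
  shows "\<exists>r\<in>G.P K. r \<in> t <#\<^bsub>G.G\<^esub> G.H i"
proof -
  interpret sw: free_product_sys \<beta> \<alpha> \<gamma> f e lb la "\<lambda>Y X. W X Y" by (rule swap)
  show ?thesis
    using meet_step_left[OF _ assms(2-4)] sw.meet_step_left[OF _ assms(2-4)] assms(1) types by blast
qed

text \<open>Two cosets of the same type with a common element are equal, so a flag has at most one
  element of each of the finitely many types. This makes induction on flags possible.\<close>

lemma finite_flag:
  assumes "flag G.S F"
  shows "finite F"
proof (rule inj_on_finite)
  show "inj_on fst F"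
  proof (rule inj_onI)
    fix x y assume xy: "x \<in> F" "y \<in> F" "fst x = fst y"
    then obtain g where "g \<in> snd x" "g \<in> snd y"
      using assms unfolding G.flag_iff by blast
    then show "x = y"
      using assms xy G.coset_eq(2)[of "fst x" "snd x" g] G.coset_eq(2)[of "fst y" "snd y" g]
      unfolding G.flag_iff prod_eq_iff by metis
  qed
  show "fst ` F \<subseteq> G.I" using G.flag_type_subset[OF assms] by (simp add: G.flag_type_eq)
  show "finite G.I" using types finite_types by simp
qed

text \<open>Induction on the flag: a common element \<open>g\<close> of \<open>F\<close> allows a
  translation that makes \<open>F\<close> standard, and then \<open>meet_step\<close> adds one more
  coset.\<close>

lemma flags_meet: "flags_meet \<gamma>"
proof -
  have "\<exists>g\<in>carrier G.G. \<forall>x\<in>F. g \<in> snd x" if "finite F" "flag G.S F" for F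
    using that
  proof (induction F rule: finite_induct)
    case empty
    then show ?case using G.G.one_closed by blast
  next
    case (insert x F)
    have F: "flag G.S F" using insert.prems by (simp add: flag_def)
    then obtain g where g: "g \<in> carrier G.G" "\<forall>y\<in>F. g \<in> snd y" using insert.IH by blast
    obtain i C where x: "x = (i, C)" by (cases x)
    have iC: "i \<in> G.I" "C \<in> lcosets\<^bsub>G.G\<^esub> (G.H i)" and Cne: "\<And>y. y \<in> F \<Longrightarrow> C \<inter> snd y \<noteq> {}"
      using insert.prems by (auto simp: G.flag_iff x)
    obtain a where a: "a \<in> carrier G.G" "C = a <#\<^bsub>G.G\<^esub> G.H i"
      using iC by (auto simp: LCOSETS_def)
    let ?K = "flag_type G.S F"
    have K: "?K \<subseteq> G.I" using F by (rule G.flag_type_subset)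
    have Feq: "F = G.std g ?K" by (rule G.common_element_std[OF F g(1)]) (use g in auto)
    \<comment> \<open>A representative of the new coset after translating by the inverse of
      \<open>g\<close>.\<close>
    let ?t = "inv\<^bsub>G.G\<^esub> g \<otimes>\<^bsub>G.G\<^esub> a"
    have tG: "?t \<in> carrier G.G" using g a by simp
    have shift: "inv\<^bsub>G.G\<^esub> ?t \<otimes>\<^bsub>G.G\<^esub> r = inv\<^bsub>G.G\<^esub> a \<otimes>\<^bsub>G.G\<^esub> (g \<otimes>\<^bsub>G.G\<^esub> r)" if "r \<in> carrier G.G" for r
      using that g a by (simp add: G.G.inv_mult_group G.G.m_assoc)
    have "\<exists>r\<in>G.P ?K. r \<in> ?t <#\<^bsub>G.G\<^esub> G.H i"
    proof (rule meet_step[OF iC(1) K tG])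
      fix k assume k: "k \<in> ?K"
      then have kI: "k \<in> G.I" using K by blast
      have "(k, g <#\<^bsub>G.G\<^esub> G.H k) \<in> F" by (subst Feq) (use k in \<open>simp add: std_flag_def\<close>)
      then obtain h where h: "h \<in> C" "h \<in> g <#\<^bsub>G.G\<^esub> G.H k" using Cne by fastforce
      have hG: "h \<in> carrier G.G" using G.coset_eq(1)[OF iC h(1)] .
      \<comment> \<open>An element \<open>h\<close> shared by the new coset and the one of type
        \<open>k\<close> is translated along with them.\<close>
      let ?r = "inv\<^bsub>G.G\<^esub> g \<otimes>\<^bsub>G.G\<^esub> h"
      have "?r \<in> G.H k" using h(2) G.coset_mem_iff[OF kI g(1) hG] by simp
      moreover have "g \<otimes>\<^bsub>G.G\<^esub> ?r = h" using g hG by (simp flip: G.G.m_assoc)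
      then have "?r \<in> ?t <#\<^bsub>G.G\<^esub> G.H i"
        using G.coset_mem_iff[OF iC(1) tG, of ?r] G.coset_mem_iff[OF iC(1) a(1) hG] shift[of ?r] h(1) a(2) g(1) hG
        by simp
      ultimately show "(?t <#\<^bsub>G.G\<^esub> G.H i) \<inter> G.H k \<noteq> {}" by blast
    qed
    then obtain r where r: "r \<in> G.P ?K" "r \<in> ?t <#\<^bsub>G.G\<^esub> G.H i" by blast
    then have rG: "r \<in> carrier G.G" by (simp add: parabolic_def)
    have grG: "g \<otimes>\<^bsub>G.G\<^esub> r \<in> carrier G.G" using g rG by simp
    have "g \<otimes>\<^bsub>G.G\<^esub> r \<in> snd x"
      using r(2) G.coset_mem_iff[OF iC(1) tG rG] G.coset_mem_iff[OF iC(1) a(1) grG] shift[OF rG]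
      by (simp add: x a(2))
    moreover have "g \<otimes>\<^bsub>G.G\<^esub> r \<in> snd y" if "y \<in> F" for y
    proof -
      have "y \<in> G.std g ?K" using that Feq by simp
      then obtain k where k: "k \<in> ?K" "y = (k, g <#\<^bsub>G.G\<^esub> G.H k)" by (auto simp: std_flag_def)
      then show ?thesis using r(1) by (auto simp: parabolic_def l_coset_def)
    qed
    ultimately show ?case using grG by blast
  qed
  then show ?thesis
    unfolding flags_meet_def using finite_flag by simp
qed

section \<open>Residual connectedness and firmness of the product\<close>

sublocale G: flag_transitive_sys \<gamma>
  by unfold_locales (rule flags_meet)

lemma residually_connected_iff:
  "residually_connected G.S \<longleftrightarrow> residually_connected A.S \<and> residually_connected B.S"
proof -
  interpret sw: free_product_sys \<beta> \<alpha> \<gamma> f e lb la "\<lambda>Y X. W X Y" by (rule swap)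
  show ?thesis
  proof
    assume "residually_connected G.S"
    then show "residually_connected A.S \<and> residually_connected B.S"
      using residual_left sw.residual_left
      unfolding G.residually_connected_iff A.residually_connected_iff B.residually_connected_iff
      by simp
  next
    assume "residually_connected A.S \<and> residually_connected B.S"
    then have gen: "\<forall>J\<subseteq>A.I. 2 \<le> card (A.I - J) \<longrightarrow>
        A.P J \<subseteq> generate A.G (\<Union>i\<in>A.I - J. A.P (insert i J))"
      "\<forall>J\<subseteq>B.I. 2 \<le> card (B.I - J) \<longrightarrow>
        B.P J \<subseteq> generate B.G (\<Union>i\<in>B.I - J. B.P (insert i J))"
      unfolding A.residually_connected_iff B.residually_connected_iff by simp_all
    show "residually_connected G.S"
      unfolding G.residually_connected_iff
    proof (intro allI impI)
      fix J assume J: "J \<subseteq> G.I" "2 \<le> card (G.I - J)"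
      have "subgroup (generate G.G (\<Union>i\<in>G.I - J. G.P (insert i J))) G.G"
        by (rule G.G.generate_is_subgroup) (auto simp: parabolic_def)
      moreover have "subgroup (A.P (J \<inter> A.I)) A.G" "subgroup (B.P (J \<inter> B.I)) B.G"
        by (rule A.parabolic_subgroup B.parabolic_subgroup; blast)+
      \<comment> \<open>\<open>G.P J\<close> is the least subgroup containing the images of its
        parts in the two factors, so each image can be treated separately.\<close>
      ultimately show "G.P J \<subseteq> generate G.G (\<Union>i\<in>G.I - J. G.P (insert i J))"
        using image_e_left[OF gen(1) J] sw.image_e_left[OF gen(2) J]
        unfolding parabolic_eq[OF J(1)] by (intro W_least)
    qed
  qed
qed

lemma firm_iff: "firm G.S \<longleftrightarrow> firm A.S \<and> firm B.S"
proof -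
  interpret sw: free_product_sys \<beta> \<alpha> \<gamma> f e lb la "\<lambda>Y X. W X Y" by (rule swap)
  have "finite G.I" using types finite_types by simp
  then show ?thesis
    using G.firm_iff A.firm_iff[OF finite_types(1)] B.firm_iff[OF finite_types(2)]
      firm_left sw.firm_left
    by (simp add: types ball_Un)
qed

end

text \<open>The subgroups of the product are defined by generators;
  \<open>words_over_eq_generate\<close> turns them into sets of words, as the locale
  requires.\<close>

lemma coset_free_product_sys:
  fixes \<alpha> :: "('a, 'i) coset_system" and \<beta> :: "('b, 'i) coset_system"
  assumes "coset_incidence_system \<alpha>" and "coset_incidence_system \<beta>"
    and fin: "finite (cs_types \<alpha>)" "finite (cs_types \<beta>)"
    and disj: "cs_types \<alpha> \<inter> cs_types \<beta> = {}"
    and "flag_transitive \<alpha>" and "flag_transitive \<beta>"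
  shows "free_product_sys \<alpha> \<beta> (coset_free_product \<alpha> \<beta>)
    (embL (cs_group \<alpha>)) (embR (cs_group \<beta>)) lettersL lettersR
    (group_pair.words_over (cs_group \<alpha>) (cs_group \<beta>))"
proof -
  let ?G = "coset_free_product \<alpha> \<beta>"
  interpret A: coset_sys \<alpha>
    using assms(1) by (auto simp: coset_sys_def coset_sys_axioms_def coset_incidence_system_def)
  interpret B: coset_sys \<beta>
    using assms(2) by (auto simp: coset_sys_def coset_sys_axioms_def coset_incidence_system_def)
  interpret A: flag_transitive_sys \<alpha>
    using assms(6) A.flag_transitive_iff by unfold_locales simp
  interpret B: flag_transitive_sys \<beta>
    using assms(7) B.flag_transitive_iff by unfold_locales simp
  interpret gp: group_pair A.G B.G ..
  have G: "cs_group ?G = free_product A.G B.G" "cs_types ?G = A.I \<union> B.I"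
    by (simp_all add: coset_free_product_def Let_def)
  have left: "cs_subgroup ?G i = gp.words_over (A.H i) (carrier B.G)" if "i \<in> A.I" for i
    using that gp.words_over_eq_generate[OF A.subgroup_type[OF that] B.G.subgroup_self]
    by (simp add: coset_free_product_def Let_def)
  have right: "cs_subgroup ?G i = gp.words_over (carrier A.G) (B.H i)" if i: "i \<in> B.I" for i
  proof -
    \<comment> \<open>The definition tests for types of \<alpha> first, so disjointness is what
      selects the second branch.\<close>
    have "i \<notin> A.I" using i disj by blast
    then show ?thesis
      using gp.words_over_eq_generate[OF A.G.subgroup_self B.subgroup_type[OF i]]
      by (simp add: coset_free_product_def Let_def)
  qed
  have sys: "coset_sys ?G"
    unfolding coset_sys_def coset_sys_axioms_def G
    using gp.group_free_product left right
      gp.subgroup_words_over[OF A.subgroup_type B.G.subgroup_self]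
      gp.subgroup_words_over[OF A.G.subgroup_self B.subgroup_type] by auto
  show ?thesis
  proof (intro free_product_sys.intro free_product_sys_axioms.intro, unfold G)
    show "lettersL w \<subseteq> carrier A.G" if "w \<in> carrier (free_product A.G B.G)" for w
      using that by (auto simp: lettersL_def free_product_def reduced_words_def)
    show "lettersR w \<subseteq> carrier B.G" if "w \<in> carrier (free_product A.G B.G)" for w
      using that by (auto simp: lettersR_def free_product_def reduced_words_def)
    show "gp.words_over X Y \<subseteq> K"
      if "subgroup X A.G" "subgroup Y B.G" "subgroup K (free_product A.G B.G)"
        "embL A.G ` X \<subseteq> K" "embR B.G ` Y \<subseteq> K" for X Y K
      unfolding gp.words_over_eq_generate[OF that(1,2)]
      using that(3-5) by (intro group.generate_subgroup_incl gp.group_free_product) auto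
    show "gp.words_over X Y = {w \<in> carrier (free_product A.G B.G). lettersL w \<subseteq> X \<and> lettersR w \<subseteq> Y}"
      for X Y by (rule gp.words_over_def)
  qed (fact A.flag_transitive_sys_axioms B.flag_transitive_sys_axioms sys fin disj refl left right
      gp.embL_hom gp.embR_hom letters_emb gp.subgroup_words_over gp.coset_prefixL gp.coset_prefixR)+
qed

theorem theorem3p8:
  fixes \<alpha> :: "('a, 'i) coset_system" and \<beta> :: "('b, 'i) coset_system"
  assumes "coset_incidence_system \<alpha>" and "coset_incidence_system \<beta>"
    and "finite (cs_types \<alpha>)" and "finite (cs_types \<beta>)"
    and "cs_types \<alpha> \<inter> cs_types \<beta> = {}"
    and "flag_transitive \<alpha>" and "flag_transitive \<beta>"
  shows "flag_transitive (coset_free_product \<alpha> \<beta>) \<and>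
    coset_geometry (coset_free_product \<alpha> \<beta>) \<and>
    (residually_connected (incidence_system_of (coset_free_product \<alpha> \<beta>)) \<longleftrightarrow>
       residually_connected (incidence_system_of \<alpha>) \<and>
       residually_connected (incidence_system_of \<beta>)) \<and>
    (firm (incidence_system_of (coset_free_product \<alpha> \<beta>)) \<longleftrightarrow>
       firm (incidence_system_of \<alpha>) \<and> firm (incidence_system_of \<beta>))"
proof -
  interpret free_product_sys \<alpha> \<beta> "coset_free_product \<alpha> \<beta>" "embL (cs_group \<alpha>)" "embR (cs_group \<beta>)"
    lettersL lettersR "group_pair.words_over (cs_group \<alpha>) (cs_group \<beta>)"
    using assms by (rule coset_free_product_sys)
  show ?thesis
    using G.flag_transitive_iff flags_meet G.geometry G.G.is_group G.subgroup_type
      residually_connected_iff firm_iff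
    by (simp add: coset_geometry_def coset_incidence_system_def)
qed

end
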